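(* Fix an integer $d\ge 1$, a window size $\lambda>0$ (so $W=[0,\lambda]^d$) and a threshold $\ell\in\mathbb Z_+$. Let $A$ be any one of the following sets of finite point configurations $\boldsymbol x$ in $W$, where $G(\boldsymbol x)$ is the graph with vertex set $\boldsymbol x$ and an edge between distinct $x,x'\in\boldsymbol x$ if and only if $\|x-x'\|\le 1$: 1. the number of edges of $G(\boldsymbol x)$ is at most $\ell$; 2. the maximum degree of $G(\boldsymbol x)$ is at most $\ell$; 3. every connected component of $G(\boldsymbol x)$ has at most $\ell+1$ vertices; 4. every clique of $G(\boldsymbol x)$ has at most $\ell+1$ vertices; 5. the number of triangles of $G(\boldsymbol x)$ is at most $\ell$; 6. $G(\boldsymbol x)$ is planar. Then, as the intensity $\kappa\to\infty$, both the conditional Monte Carlo estimator $\widehat Y$ and the importance sampling estimator $\widetilde Y$ of $p^*=\mathbb P(\boldsymbol X\in A)$ have bounded relative error: $$\limsup_{\kappa\to\infty}\frac{\mathrm{Var}_\rho(\widehat Y)}{(p^* )^2}<\infty\qquad\text{and}\qquad\limsup_{\kappa\to\infty}\frac{\mathrm{Var}_\mu(\widetilde Y)}{(p^* )^2}<\infty.$$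
   Context: $\|\cdot\|$ is the Euclidean norm. A triangle is a clique with 3 vertices. Configurations are finite subsets of $W$ (the empty configuration belongs to each $A$; its graph has maximum degree $0$, etc.). Poisson process: $\boldsymbol X$ is a homogeneous Poisson point process on $W$ of intensity $\kappa$. Put $\beta=\kappa\lambda^d$ and $q_n=e^{-\beta}\beta^n/n!$ for $n\in\mathbb Z_+=\{0,1,2,\dots\}$. Under $\rho$, $X_1,X_2,\dots$ are i.i.d. uniform on $W$. In all cases $\boldsymbol X_n=\{X_1,\dots,X_n\}$ (with $\boldsymbol X_0=\varnothing$). Importance sampling measure: $\mu$ is the law of a random sequence $X_1,X_2,\dots$ of points in $W$ generated sequentially (each point may depend on the previous ones, and the generation may be stopped at a random time, in which case $\mathbb I(\boldsymbol X_n\in A)=0$ for all later $n$), and $L$ is a measurable $[0,1]$-valued function of ordered finite tuples of points whose underlying configuration is in $A$, with $L(\varnothing)=1$; one writes $L(\boldsymbol X_n)$ for $L(X_1,\dots,X_n)$. $L$ is the Radon–Nikodym derivative of $\rho$ with respect to $\mu$ on $A$: for every $n\ge 0$ and every bounded measurable $f:W^n\to\mathbb R$, $$\mathbb E_\rho[f(X_1,\dots,X_n)\,\mathbb I(\boldsymbol X_n\in A)]=\mathbb E_\mu[f(X_1,\dots,X_n)\,\mathbb I(\boldsymbol X_n\in A)\,L(\boldsymbol X_n)].$$ Estimators (both unbiased for $p^*$): - $\widehat Y=\sum_{n\in\mathbb Z_+}q_n\,\mathbb I(\boldsymbol X_n\in A)$ with $X_1,X_2,\dots$ generated under $\rho$;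 - $\widetilde Y=\sum_{n\in\mathbb Z_+}q_n\,\mathbb I(\boldsymbol X_n\in A)\,L(\boldsymbol X_n)$ with $X_1,X_2,\dots$ generated under $\mu$. Subscripts $\rho,\mu$ indicate the law of the points used. *)

theory Defs
  imports "HOL-Probability.Probability" "HOL-Library.Ramsey"
begin

section \<open>Random geometric graphs in a cubic window\<close>

definition window :: "real \<Rightarrow> (real ^ 'd) set" where
  "window lam = {x. \<forall>i. 0 \<le> x $ i \<and> x $ i \<le> lam}"

definition configs :: "real \<Rightarrow> (real ^ 'd) set set" where
  "configs lam = {V. finite V \<and> V \<subseteq> window lam}"

text \<open>A simple graph is given by a vertex set and a set of two-element edges, as expected by
  the library constant \<^const>\<open>clique\<close>; the graph of a configuration \<open>V\<close> has vertex set \<open>V\<close>.\<close>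

definition geo_edges :: "'a::real_normed_vector set \<Rightarrow> 'a set set" where
  "geo_edges V = {{u, v} |u v. u \<in> V \<and> v \<in> V \<and> u \<noteq> v \<and> norm (u - v) \<le> 1}"

definition degree :: "'a set set \<Rightarrow> 'a \<Rightarrow> nat" where
  "degree E u = card {v. {u, v} \<in> E}"

text \<open>Inserting \<open>0\<close> only matters for the empty graph, whose maximum degree is \<open>0\<close>.\<close>

definition max_degree :: "'a set \<Rightarrow> 'a set set \<Rightarrow> nat" where
  "max_degree V E = Max (insert 0 (degree E ` V))"

definition components_of :: "'a set \<Rightarrow> 'a set set \<Rightarrow> 'a set set" where
  "components_of V E = (\<lambda>u. {v. (u, v) \<in> {(a, b). {a, b} \<in> E}\<^sup>*}) ` V"

definition triangles :: "'a set \<Rightarrow> 'a set set \<Rightarrow> 'a set set" where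
  "triangles V E = {S. S \<subseteq> V \<and> clique S E \<and> card S = 3}"

text \<open>Planarity in the topological sense: the graph can be drawn in the plane with distinct
  points as vertices and simple arcs as edges, an arc containing no vertices besides its two ends
  and two distinct arcs meeting only in the image of a common end.\<close>

definition planar :: "'a set \<Rightarrow> 'a set set \<Rightarrow> bool" where
  "planar V E \<longleftrightarrow> (\<exists>(pos :: 'a \<Rightarrow> complex) (curve :: 'a set \<Rightarrow> real \<Rightarrow> complex).
     inj_on pos V \<and>
     (\<forall>e\<in>E. arc (curve e) \<and> {pathstart (curve e), pathfinish (curve e)} = pos ` e \<and>
        path_image (curve e) \<inter> pos ` V = pos ` e) \<and>
     (\<forall>e\<in>E. \<forall>e'\<in>E. e \<noteq> e' \<longrightarrow>
        path_image (curve e) \<inter> path_image (curve e') \<subseteq> pos ` (e \<inter> e')))"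

definition few_edges :: "real \<Rightarrow> nat \<Rightarrow> (real ^ 'd) set set" where
  "few_edges lam l = {V \<in> configs lam. card (geo_edges V) \<le> l}"

definition small_degree :: "real \<Rightarrow> nat \<Rightarrow> (real ^ 'd) set set" where
  "small_degree lam l = {V \<in> configs lam. max_degree V (geo_edges V) \<le> l}"

definition small_components :: "real \<Rightarrow> nat \<Rightarrow> (real ^ 'd) set set" where
  "small_components lam l =
     {V \<in> configs lam. \<forall>C \<in> components_of V (geo_edges V). card C \<le> l + 1}"

definition small_cliques :: "real \<Rightarrow> nat \<Rightarrow> (real ^ 'd) set set" where
  "small_cliques lam l =
     {V \<in> configs lam. \<forall>S \<subseteq> V. clique S (geo_edges V) \<longrightarrow> card S \<le> l + 1}"

definition few_triangles :: "real \<Rightarrow> nat \<Rightarrow> (real ^ 'd) set set" where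
  "few_triangles lam l = {V \<in> configs lam. card (triangles V (geo_edges V)) \<le> l}"

definition planar_configs :: "real \<Rightarrow> (real ^ 'd) set set" where
  "planar_configs lam = {V \<in> configs lam. planar V (geo_edges V)}"


section \<open>Poisson point processes\<close>

text \<open>Unlike the library's \<open>poisson_pmf\<close>, this also covers the mean \<open>m = 0\<close> (where \<open>0 ^ 0 = 1\<close>),
  which is needed for Lebesgue null sets.\<close>

definition poisson_prob :: "real \<Rightarrow> nat \<Rightarrow> real" where
  "poisson_prob m n = exp (- m) * m ^ n / fact n"

definition poisson_process ::
    "'w measure \<Rightarrow> 'a::euclidean_space set \<Rightarrow> real \<Rightarrow> ('w \<Rightarrow> 'a set) \<Rightarrow> bool" where
  "poisson_process M W kappa X \<longleftrightarrow>
     prob_space M \<and>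
     (\<forall>w \<in> space M. finite (X w) \<and> X w \<subseteq> W) \<and>
     (\<forall>B \<in> sets borel. B \<subseteq> W \<longrightarrow>
        (\<lambda>w. card (X w \<inter> B)) \<in> measurable M (count_space UNIV) \<and>
        (\<forall>k. measure M {w \<in> space M. card (X w \<inter> B) = k} =
             poisson_prob (kappa * measure lborel B) k)) \<and>
     (\<forall>n (B :: nat \<Rightarrow> 'a set).
        (\<forall>i<n. B i \<in> sets borel \<and> B i \<subseteq> W) \<and> disjoint_family_on B {..<n} \<longrightarrow>
        prob_space.indep_vars M (\<lambda>_. count_space UNIV) (\<lambda>i w. card (X w \<inter> B i)) {..<n})"


section \<open>Sampling measures and estimators\<close>

text \<open>A sequence \<open>x\<close> of points is indexed from \<open>0\<close>, so the first \<open>n\<close> points are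
  \<open>x 0, \<dots>, x (n - 1)\<close>.\<close>

definition first :: "nat \<Rightarrow> (nat \<Rightarrow> 'a) \<Rightarrow> 'a list" where
  "first n x = map x [0..<n]"

definition iid_uniform :: "'a::euclidean_space set \<Rightarrow> (nat \<Rightarrow> 'a) measure" where
  "iid_uniform W = Pi\<^sub>M UNIV (\<lambda>_. uniform_measure lborel W)"

text \<open>A randomly stopped sequence is a pair \<open>(x, t)\<close> with \<open>t\<close> the (possibly infinite) number of
  points generated; the values \<open>x i\<close> for \<open>i \<ge> t\<close> are meaningless. The following is the indicator
  of the event that at least \<open>n\<close> points are generated and the first \<open>n\<close> of them form a
  configuration in \<open>A\<close>.\<close>

definition stopped_ind :: "'a set set \<Rightarrow> nat \<Rightarrow> (nat \<Rightarrow> 'a) \<times> enat \<Rightarrow> real" where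
  "stopped_ind A n = (\<lambda>(x, t). of_bool (enat n \<le> t \<and> set (first n x) \<in> A))"

text \<open>\<open>mu\<close> is the law of a randomly stopped sequence in \<open>W\<close>, and \<open>L\<close> the density on \<open>A\<close> of the
  i.i.d. uniform law with respect to \<open>mu\<close>. Only the values of \<open>L\<close> on tuples whose underlying
  configuration lies in \<open>A\<close> are constrained.\<close>

definition importance_sampling ::
    "'a::euclidean_space set \<Rightarrow> 'a set set \<Rightarrow> ((nat \<Rightarrow> 'a) \<times> enat) measure \<Rightarrow>
     ('a list \<Rightarrow> real) \<Rightarrow> bool" where
  "importance_sampling W A mu L \<longleftrightarrow>
     prob_space mu \<and>
     sets mu = sets (Pi\<^sub>M UNIV (\<lambda>_. borel) \<Otimes>\<^sub>M count_space UNIV) \<and>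
     (AE (x, t) in mu. \<forall>i. enat i < t \<longrightarrow> x i \<in> W) \<and>
     (\<forall>xs. set xs \<in> A \<longrightarrow> 0 \<le> L xs \<and> L xs \<le> 1) \<and>
     (\<forall>n. (\<lambda>x. L (first n x)) \<in> borel_measurable
        (restrict_space (Pi\<^sub>M {..<n} (\<lambda>_. borel)) {x. set (first n x) \<in> A})) \<and>
     L [] = 1 \<and>
     (\<forall>n (f :: 'a list \<Rightarrow> real).
        (\<lambda>x. f (first n x)) \<in> borel_measurable (Pi\<^sub>M {..<n} (\<lambda>_. restrict_space borel W)) \<and>
        bounded (f ` {xs. length xs = n \<and> set xs \<subseteq> W}) \<longrightarrow>
        (\<integral>x. f (first n x) * of_bool (set (first n x) \<in> A) \<partial>iid_uniform W) =
        (\<integral>\<omega>. f (first n (fst \<omega>)) * stopped_ind A n \<omega> * L (first n (fst \<omega>)) \<partial>mu))"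

definition cmc_estimator :: "real \<Rightarrow> 'a set set \<Rightarrow> (nat \<Rightarrow> 'a) \<Rightarrow> real" where
  "cmc_estimator beta A x =
     (\<Sum>n. poisson_prob beta n * of_bool (set (first n x) \<in> A))"

definition is_estimator ::
    "real \<Rightarrow> 'a set set \<Rightarrow> ('a list \<Rightarrow> real) \<Rightarrow> (nat \<Rightarrow> 'a) \<times> enat \<Rightarrow> real" where
  "is_estimator beta A L \<omega> =
     (\<Sum>n. poisson_prob beta n * stopped_ind A n \<omega> * L (first n (fst \<omega>)))"

text \<open>The division is that of \<^typ>\<open>ereal\<close>, so a positive variance over \<open>p = 0\<close> gives \<open>\<infinity>\<close>
  rather than \<open>0\<close>.\<close>

definition relative_variance :: "'w measure \<Rightarrow> ('w \<Rightarrow> real) \<Rightarrow> real \<Rightarrow> ereal" where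
  "relative_variance M Y p = ereal (prob_space.variance M Y) / ereal (p\<^sup>2)"

end

theory Submission
  imports Defs
begin

text \<open>All six families are invariant under isomorphism of the geometric graph and bound the size
  of its cliques (for planarity because \<open>K\<^sub>5\<close> is not planar). Covering the window by balls
  of radius \<open>1/2\<close> bounds the number of points of a configuration in \<open>A\<close>. Almost surely no two
  i.i.d. points coincide or have distance exactly \<open>1\<close>, so a sampled configuration in \<open>A\<close> stays in
  \<open>A\<close> under small perturbations; let \<open>N\<close> be the largest size of such a robust
  configuration. Both estimators are then almost surely at most
  \<open>q\<^sub>0 + \<dots> + q\<^sub>N \<le> (N + 1) exp (- \<beta>) \<beta>\<^sup>N\<close> (for \<open>\<beta> \<ge> 1\<close>), whereas \<open>p\<close> is at least the probability that the Poisson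
  process has exactly one point in each of \<open>N\<close> fixed small balls and none elsewhere, which is
  a constant times \<open>exp (- \<beta>) \<kappa>\<^sup>N\<close>.\<close>

text \<open>Taking \<open>N\<close> (\<open>max_robust\<close>) as the largest robust size, not the
  largest size in \<open>A\<close>, makes a lower bound for \<open>p\<close> of order
  \<open>N\<close> available by definition; the price is that the upper bounds hold only outside a
  null set. Some null set has to be discarded in any case: a sequence that repeats points can keep
  \<open>set (first n x)\<close> in \<open>A\<close> for all \<open>n\<close>. The law
  \<open>mu\<close> may give such sequences positive probability, but the density identity with the
  constant test function 1 makes the weights of all lengths above \<open>N\<close> vanish
  \<open>mu\<close>-almost surely.

  Bounding the variance by the square of an almost sure upper bound suffices because that bound and
  the lower bound for \<open>p\<close> have the same order. The cells of the Poisson event partition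
  the window, so its exponential factors multiply to exactly \<open>exp (- beta)\<close>; they
  cancel in the quotient, and so does \<open>kappa ^ N\<close>. What remains is one constant for all
  \<open>kappa\<close> with \<open>beta\<close> at least 1, so no limit is computed.

  Planarity is topological here; its clique bound rests on the Jordan curve theorem and
  Janiszewski's theorem instead of Euler's formula.\<close>

section \<open>Planar drawings of complete graphs\<close>

text \<open>In an embedded theta graph formed by \<open>S\<close>, \<open>T\<close> and \<open>C\<close>, a connected set \<open>K\<close> touching
  the interiors of both \<open>S\<close> and \<open>T\<close> cannot lie on the same side of the closed curve
  \<open>S \<union> T\<close> as \<open>C\<close>: with \<open>G\<close> the other side, \<open>K\<close> and \<open>G\<close> are connected outside
  \<open>S \<union> C\<close> and outside \<open>T \<union> C\<close>, hence, by Janiszewski's theorem, outside \<open>S \<union> T\<close>.\<close>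

lemma Janiszewski_theta:
  fixes S T C G K :: "complex set"
  assumes comp: "compact S" "compact T" "compact C"
    and C: "connected C" "S \<inter> T \<subseteq> C"
    and G: "connected G" "G \<inter> (S \<union> T \<union> C) = {}" "S \<union> T \<subseteq> closure G" "g \<in> G"
    and K: "connected K" "K \<inter> (S \<union> T \<union> C) = {}" "k \<in> K"
    and s: "s \<in> S - C" "s \<in> closure K" and t: "t \<in> T - C" "t \<in> closure K"
  shows "connected_component (- (S \<union> T)) k g"
proof -
  \<comment> \<open>A common limit point \<open>z\<close> outside \<open>Y \<union> C\<close> glues
    \<open>K\<close> and \<open>G\<close> into one connected set that avoids
    \<open>Y \<union> C\<close>.\<close>
  have aux: "connected_component (- (Y \<union> C)) k g"
    if "z \<in> closure K" "z \<in> closure G" "z \<notin> Y \<union> C" "Y \<subseteq> S \<union> T" for Y z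
    unfolding connected_component_def
  proof (intro exI conjI)
    have "connected (insert z K)" "connected (insert z G)"
      using that closure_subset
      by (auto intro: connected_intermediate_closure[OF K(1)] connected_intermediate_closure[OF G(1)])
    then show "connected (insert z K \<union> insert z G)"
      by (rule connected_Un) auto
    show "insert z K \<union> insert z G \<subseteq> - (Y \<union> C)"
      using that G(2) K(2) by blast
  qed (use K G in auto)
  have "connected_component (- ((T \<union> C) \<union> (S \<union> C))) k g"
  proof (rule Janiszewski)
    \<comment> \<open>Since \<open>S \<inter> T \<subseteq> C\<close>, the point \<open>s\<close> of
      \<open>S - C\<close> also misses \<open>T\<close>, so it can serve as the gluing point outside
      \<open>T \<union> C\<close>; \<open>t\<close> serves symmetrically.\<close>
    show "connected_component (- (T \<union> C)) k g"
      using s C(2) G(3) by (intro aux[of s]) auto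
    show "connected_component (- (S \<union> C)) k g"
      using t C(2) G(3) by (intro aux[of t]) auto
    have "(T \<union> C) \<inter> (S \<union> C) = C" using C(2) by auto
    then show "connected ((T \<union> C) \<inter> (S \<union> C))" using C by simp
  qed (use comp in \<open>auto intro: compact_imp_closed\<close>)
  then show ?thesis
    by (rule connected_component_of_subset) auto
qed

text \<open>Half-open arcs are the legs of the open star at \<open>x\<close> below: each keeps the
  centre, which connects the legs, and still accumulates at its removed outer vertex.\<close>

lemma connected_arc_minus_finish:
  assumes "arc g"
  shows "connected (path_image g - {pathfinish g})" "pathfinish g \<in> closure (path_image g - {pathfinish g})"
proof -
  have inj: "inj_on g {0..1}" and cont: "continuous_on {0..1} g"
    using assms by (simp_all add: arc_def path_def)
  have "g ` {0..1} - g ` {1} = g ` ({0..1} - {1})"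
    by (subst inj_on_image_set_diff[OF inj]) auto
  moreover have "{0..1} - {1} = {0..<1::real}" by auto
  ultimately have eq: "path_image g - {pathfinish g} = g ` {0..<1}"
    by (simp add: path_image_def pathfinish_def)
  have "continuous_on {0..<1} g"
    by (rule continuous_on_subset[OF cont]) auto
  then show "connected (path_image g - {pathfinish g})"
    unfolding eq by (intro connected_continuous_image) auto
  have "g ` {0..1} \<subseteq> closure (g ` {0..<1})"
    using continuous_image_closure_subset[OF cont, of "{0..<1}"] by simp
  then have "g 1 \<in> closure (g ` {0..<1})" by auto
  then show "pathfinish g \<in> closure (path_image g - {pathfinish g})"
    unfolding eq by (simp add: pathfinish_def)
qed

text \<open>In a drawing of \<open>K\<^sub>5\<close> on \<open>a, b, c, d, x\<close>, consider the closed curve \<open>a c b d\<close>.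
  The chords \<open>a b\<close>, \<open>c d\<close> and the open star centred at \<open>x\<close> would pairwise lie on
  opposite sides of it, but it has only two sides.\<close>

lemma planar_clique_card_le_4:
  assumes "planar V E" "S \<subseteq> V" "clique S E" "finite S"
  shows "card S \<le> 4"
proof (rule ccontr)
  assume "\<not> card S \<le> 4"
  then have "5 \<le> card S" by simp
  then obtain T where T: "T \<subseteq> S" "card T = 5"
    by (metis obtain_subset_with_card_n)
  then obtain ts where ts: "set ts = T" "distinct ts" "length ts = 5"
    by (metis assms(4) distinct_card finite_distinct_list finite_subset)
  then obtain a b c d x where "ts = [a, b, c, d, x]"
    by (auto simp: numeral_eq_Suc length_Suc_conv)
  with ts have Teq: "T = {a, b, c, d, x}" and "distinct [a, b, c, d, x]"
    by auto
  then have ne: "a \<noteq> b" "a \<noteq> c" "a \<noteq> d" "a \<noteq> x" "b \<noteq> c" "b \<noteq> d" "b \<noteq> x" "c \<noteq> d" "c \<noteq> x" "d \<noteq> x"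
    by auto
  have TV: "T \<subseteq> V" using T assms by auto
  have TE: "{u, v} \<in> E" if "u \<in> T" "v \<in> T" "u \<noteq> v" for u v
    using that T assms(3) by (auto simp: clique_def)
  obtain p :: "'a \<Rightarrow> complex" and curve where inj: "inj_on p V"
    and arcs: "\<forall>e\<in>E. arc (curve e) \<and> {pathstart (curve e), pathfinish (curve e)} = p ` e \<and>
        path_image (curve e) \<inter> p ` V = p ` e"
    and disj: "\<forall>e\<in>E. \<forall>e'\<in>E. e \<noteq> e' \<longrightarrow>
        path_image (curve e) \<inter> path_image (curve e') \<subseteq> p ` (e \<inter> e')"
    using assms(1) unfolding planar_def by (elim exE conjE) (rule that; assumption)
  define B where "B u v = path_image (curve {u, v})" for u v
  have B_sym: "B u v = B v u" for u v by (simp add: B_def insert_commute)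
  have p_eq: "p u = p v \<longleftrightarrow> u = v" if "u \<in> T" "v \<in> T" for u v
    using inj that TV by (auto dest: inj_onD)
  have B_p: "p w \<in> B u v \<longleftrightarrow> w \<in> {u, v}" if "u \<in> T" "v \<in> T" "w \<in> T" "u \<noteq> v" for u v w
  proof -
    have "B u v \<inter> p ` V = p ` {u, v}"
      using bspec[OF arcs TE, of u v] that unfolding B_def by simp
    then have "p w \<in> B u v \<longleftrightarrow> p w \<in> p ` {u, v}"
      using TV \<open>w \<in> T\<close> by blast
    also have "\<dots> \<longleftrightarrow> p w = p u \<or> p w = p v" by simp
    also have "\<dots> \<longleftrightarrow> w \<in> {u, v}" by (simp add: p_eq[OF that(3,1)] p_eq[OF that(3,2)])
    finally show ?thesis .
  qed
  have B_int: "B u v \<inter> B u' v' \<subseteq> p ` ({u, v} \<inter> {u', v'})"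
    if "u \<in> T" "v \<in> T" "u \<noteq> v" "u' \<in> T" "v' \<in> T" "u' \<noteq> v'" "{u, v} \<noteq> {u', v'}" for u v u' v'
    using bspec[OF bspec[OF disj TE] TE, of u v u' v'] that unfolding B_def by simp
  have B_arc: "\<exists>g. arc g \<and> path_image g = B u v \<and> pathstart g = p u \<and> pathfinish g = p v"
    if "u \<in> T" "v \<in> T" "u \<noteq> v" for u v
  proof -
    let ?g = "curve {u, v}"
    have *: "arc ?g" "{pathstart ?g, pathfinish ?g} = {p u, p v}"
      using bspec[OF arcs TE, of u v] that by auto
    \<comment> \<open>An edge is an unordered pair and fixes only the set of ends of its curve, so
      the curve may have to be reversed.\<close>
    then consider "pathstart ?g = p u" "pathfinish ?g = p v" | "pathstart ?g = p v" "pathfinish ?g = p u"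
      by (auto simp: doubleton_eq_iff)
    then show ?thesis
    proof cases
      case 1 then show ?thesis using * unfolding B_def by blast
    next
      case 2 then show ?thesis using * unfolding B_def
        by (intro exI[of _ "reversepath ?g"]) (auto simp: arc_reversepath)
    qed
  qed
  have T_mem: "a \<in> T" "b \<in> T" "c \<in> T" "d \<in> T" "x \<in> T" using Teq by auto
  note simps = T_mem ne ne[symmetric] p_eq B_p
  have compB: "compact (B u v)" if "u \<in> T" "v \<in> T" "u \<noteq> v" for u v
    using B_arc[OF that] by (metis compact_arc_image)
  have conB: "connected (B u v)" if "u \<in> T" "v \<in> T" "u \<noteq> v" for u v
    using B_arc[OF that] by (metis connected_arc_image)
  have conB_open: "connected (B u v - {p u, p v})" if "u \<in> T" "v \<in> T" "u \<noteq> v" for u v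
    using B_arc[OF that] by (metis connected_simple_path_endless arc_imp_simple_path)
  have conB_half: "connected (B u v - {p v})" "p v \<in> closure (B u v - {p v})"
    if "u \<in> T" "v \<in> T" "u \<noteq> v" for u v
    using B_arc[OF that] by (metis connected_arc_minus_finish)+
  have closB_open: "p v \<in> closure (B u v - {p u, p v})" "p u \<in> closure (B u v - {p u, p v})"
    if "u \<in> T" "v \<in> T" "u \<noteq> v" for u v
  proof -
    obtain g where g: "arc g" "path_image g = B u v" "pathstart g = p u" "pathfinish g = p v"
      using B_arc[OF \<open>u \<in> T\<close> \<open>v \<in> T\<close> \<open>u \<noteq> v\<close>] by blast
    have eq: "B u v - {p u, p v} = g ` {0<..<1}"
      using simple_path_endless[of g] g by (auto simp: arc_imp_simple_path)
    have "continuous_on {0..1} g" using g by (simp add: arc_def path_def)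
    then have "g ` {0..1} \<subseteq> closure (g ` {0<..<1})"
      using continuous_image_closure_subset[of "{0..1}" g "{0<..<1}"] by simp
    then have "g 0 \<in> closure (g ` {0<..<1})" "g 1 \<in> closure (g ` {0<..<1})"
      by auto
    then show "p v \<in> closure (B u v - {p u, p v})" "p u \<in> closure (B u v - {p u, p v})"
      unfolding eq using g by (auto simp: pathstart_def pathfinish_def)
  qed
  define J where "J = B a c \<union> B c b \<union> (B b d \<union> B d a)"
  obtain g1 where g1: "arc g1" "path_image g1 = B a c" "pathstart g1 = p a" "pathfinish g1 = p c"
    using B_arc[of a c] by (auto simp: simps)
  obtain g2 where g2: "arc g2" "path_image g2 = B c b" "pathstart g2 = p c" "pathfinish g2 = p b"
    using B_arc[of c b] by (auto simp: simps)
  obtain g3 where g3: "arc g3" "path_image g3 = B b d" "pathstart g3 = p b" "pathfinish g3 = p d"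
    using B_arc[of b d] by (auto simp: simps)
  obtain g4 where g4: "arc g4" "path_image g4 = B d a" "pathstart g4 = p d" "pathfinish g4 = p a"
    using B_arc[of d a] by (auto simp: simps)
  have int: "B a c \<inter> B c b \<subseteq> {p c}" "B b d \<inter> B d a \<subseteq> {p d}"
    "B a c \<inter> B b d \<subseteq> {}" "B a c \<inter> B d a \<subseteq> {p a}" "B c b \<inter> B b d \<subseteq> {p b}" "B c b \<inter> B d a \<subseteq> {}"
    using B_int[of a c c b] B_int[of b d d a] B_int[of a c b d] B_int[of a c d a]
      B_int[of c b b d] B_int[of c b d a]
    by (auto simp: simps doubleton_eq_iff)
  have h1: "arc (g1 +++ g2)"
    by (rule arc_join) (use int in \<open>auto simp: g1 g2\<close>)
  have h2: "arc (g3 +++ g4)"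
    by (rule arc_join) (use int in \<open>auto simp: g3 g4\<close>)
  define j where "j = (g1 +++ g2) +++ (g3 +++ g4)"
  have "simple_path j" unfolding j_def
    by (rule simple_path_join_loop[OF h1 h2]) (use int in \<open>auto simp: g1 g2 g3 g4 path_image_join\<close>)
  moreover have "pathfinish j = pathstart j" "path_image j = J"
    by (auto simp: j_def J_def path_image_join g1 g2 g3 g4)
  ultimately have Jordan: "inside J \<noteq> {}" "open (inside J)" "connected (inside J)" "outside J \<noteq> {}"
    "open (outside J)" "connected (outside J)" "inside J \<inter> outside J = {}"
    "inside J \<union> outside J = - J" "frontier (inside J) = J" "frontier (outside J) = J"
    using Jordan_inside_outside[of j] by auto
  define K1 where "K1 = B a b - {p a, p b}"
  define K2 where "K2 = B c d - {p c, p d}"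
  define K3 where "K3 = (\<Union>w\<in>{a, b, c, d}. B x w - {p w})"
  have K3_1: "(B x w - {p w}) \<inter> B u v = {}"
    if "w \<in> {a, b, c, d}" "u \<in> {a, b, c, d}" "v \<in> {a, b, c, d}" "u \<noteq> v" for u v w
  proof -
    have "w \<in> T" "u \<in> T" "v \<in> T" "x \<noteq> w" "x \<noteq> u" "x \<noteq> v" using that Teq ne by auto
    then show ?thesis using B_int[of x w u v] that T_mem by (auto simp: doubleton_eq_iff)
  qed
  have K3_int: "K3 \<inter> B u v = {}" if "u \<in> {a, b, c, d}" "v \<in> {a, b, c, d}" "u \<noteq> v" for u v
    unfolding K3_def using K3_1[OF _ that] by blast
  have conK: "connected K1" "connected K2" "connected K3"
  proof -
    show "connected K1" "connected K2" unfolding K1_def K2_def by (auto intro!: conB_open simp: simps)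
    have "p x \<in> (\<Inter>w\<in>{a, b, c, d}. B x w - {p w})" by (simp add: simps)
    moreover have "\<forall>w\<in>{a, b, c, d}. connected (B x w - {p w})"
      by (simp add: simps conB_half)
    ultimately show "connected K3" unfolding K3_def
      by (intro connected_Union) blast+
  qed
  have "p b \<in> closure K1" "p d \<in> closure K2" "p x \<in> K3"
    unfolding K1_def K2_def K3_def by (simp_all add: simps closB_open)
  then have neK: "K1 \<noteq> {}" "K2 \<noteq> {}" "K3 \<noteq> {}"
    by auto
  have K1_int: "K1 \<inter> B u v = {}" if "u \<in> T" "v \<in> T" "u \<noteq> v" "{u, v} \<noteq> {a, b}" for u v
    unfolding K1_def using B_int[of a b u v] that by (auto simp: simps)
  have K2_int: "K2 \<inter> B u v = {}" if "u \<in> T" "v \<in> T" "u \<noteq> v" "{u, v} \<noteq> {c, d}" for u v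
    unfolding K2_def using B_int[of c d u v] that by (auto simp: simps)
  have K1_J: "K1 \<inter> J = {}" unfolding J_def Int_Un_distrib
    by (simp add: K1_int simps doubleton_eq_iff)
  have K2_J: "K2 \<inter> J = {}" unfolding J_def Int_Un_distrib
    by (simp add: K2_int simps doubleton_eq_iff)
  have K3_J: "K3 \<inter> J = {}" unfolding J_def Int_Un_distrib
    by (simp add: K3_int simps)
  have side: "K \<subseteq> inside J \<or> K \<subseteq> outside J" if "connected K" "K \<inter> J = {}" for K
    using connectedD[OF that(1) Jordan(2) Jordan(5)] that Jordan(7,8) by blast
  \<comment> \<open>\<open>F\<close> is the side of \<open>J\<close> containing \<open>K\<close> and
    the interior of the chord \<open>C\<close>, and \<open>G\<close> is the other side. The theta
    lemma, with \<open>S\<close> and \<open>R\<close> the two arcs into which \<open>C\<close> cuts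
    \<open>J\<close>, would connect \<open>F\<close> to \<open>G\<close> outside
    \<open>J\<close>.\<close>
  have sep: False
    if "K \<subseteq> F" "C - J \<subseteq> F" "open F" "open G" "connected G" "G \<noteq> {}" "F \<inter> G = {}" "F \<union> G = - J" "frontier G = J"
      "compact S" "compact R" "S \<union> R = J" "S \<inter> R \<subseteq> C" "connected K" "K \<noteq> {}" "K \<inter> C = {}"
      "compact C" "connected C" "s \<in> S - C" "s \<in> closure K" "r \<in> R - C" "r \<in> closure K"
    for K F G C S R s r
  proof -
    obtain k h where kh: "k \<in> K" "h \<in> G" using \<open>K \<noteq> {}\<close> \<open>G \<noteq> {}\<close> by blast
    have "G \<inter> (J \<union> C) = {}" "J \<subseteq> closure G" "K \<inter> (J \<union> C) = {}"
      using that by (auto simp: frontier_def)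
    then have "connected_component (- (S \<union> R)) k h"
      using that kh
      by (intro Janiszewski_theta[of S R C G h K k s r]) auto
    then obtain Y where Y: "connected Y" "Y \<subseteq> - J" "k \<in> Y" "h \<in> Y"
      unfolding connected_component_def \<open>S \<union> R = J\<close> by blast
    show False
      using connectedD[OF Y(1) \<open>open F\<close> \<open>open G\<close>] Y kh that by blast
  qed
  have sep': False
    if "K \<subseteq> F" "C - J \<subseteq> F" "F = inside J \<or> F = outside J"
      "compact S" "compact R" "S \<union> R = J" "S \<inter> R \<subseteq> C" "connected K" "K \<noteq> {}" "K \<inter> C = {}"
      "compact C" "connected C" "s \<in> S - C" "s \<in> closure K" "r \<in> R - C" "r \<in> closure K"
    for K F C S R s r
    using that(3)
  proof
    assume F: "F = inside J"
    show False by (rule sep[of K F C "outside J" S R s r]) (use that F Jordan in simp_all)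
  next
    assume F: "F = outside J"
    show False by (rule sep[of K F C "inside J" S R s r])
      (use that F Jordan in \<open>simp_all add: Int_commute Un_commute\<close>)
  qed
  have clK3: "p w \<in> closure K3" if "w \<in> {a, b, c, d}" for w
  proof -
    have "p w \<in> closure (B x w - {p w})" using that by (auto intro!: conB_half simp: simps)
    then show ?thesis using closure_mono[of "B x w - {p w}" K3] that unfolding K3_def by blast
  qed
  \<comment> \<open>The chord \<open>a b\<close> cuts \<open>J\<close> into an arc through
    \<open>c\<close> and an arc through \<open>d\<close>. Both \<open>K2\<close> and
    \<open>K3\<close> accumulate at \<open>c\<close> and \<open>d\<close>, so both are separated
    from \<open>K1\<close>.\<close>
  have AB: "\<not> (K \<subseteq> F \<and> K1 \<subseteq> F)" if "F = inside J \<or> F = outside J" "connected K" "K \<noteq> {}"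
      "K \<inter> B a b = {}" "p c \<in> closure K" "p d \<in> closure K" for K F
  proof
    assume *: "K \<subseteq> F \<and> K1 \<subseteq> F"
    show False
    proof (rule sep'[of K F "B a b" "B a c \<union> B c b" "B b d \<union> B d a" "p c" "p d"])
      have "p a \<in> J" "p b \<in> J" unfolding J_def by (auto simp: simps)
      then show "B a b - J \<subseteq> F" using * unfolding K1_def by auto
      have "p a \<in> B a b" "p b \<in> B a b" by (auto simp: simps)
      then show "(B a c \<union> B c b) \<inter> (B b d \<union> B d a) \<subseteq> B a b" using int by auto
      show "compact (B a c \<union> B c b)" "compact (B b d \<union> B d a)" "compact (B a b)" "connected (B a b)"
        by (intro compact_Un compB conB; simp add: simps)+
      show "B a c \<union> B c b \<union> (B b d \<union> B d a) = J" by (simp add: J_def)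
      show "p c \<in> B a c \<union> B c b - B a b" "p d \<in> B b d \<union> B d a - B a b"
        by (simp_all add: simps)
    qed (use that * in simp_all)
  qed
  \<comment> \<open>The same with the chords exchanged, for \<open>K3\<close> against
    \<open>K2\<close>.\<close>
  have CD: "\<not> (K \<subseteq> F \<and> K2 \<subseteq> F)" if "F = inside J \<or> F = outside J" "connected K" "K \<noteq> {}"
      "K \<inter> B c d = {}" "p a \<in> closure K" "p b \<in> closure K" for K F
  proof
    assume *: "K \<subseteq> F \<and> K2 \<subseteq> F"
    show False
    proof (rule sep'[of K F "B c d" "B d a \<union> B a c" "B c b \<union> B b d" "p a" "p b"])
      have "p c \<in> J" "p d \<in> J" unfolding J_def by (auto simp: simps)
      then show "B c d - J \<subseteq> F" using * unfolding K2_def by auto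
      have "p c \<in> B c d" "p d \<in> B c d" by (auto simp: simps)
      then show "(B d a \<union> B a c) \<inter> (B c b \<union> B b d) \<subseteq> B c d" using int by auto
      show "compact (B d a \<union> B a c)" "compact (B c b \<union> B b d)" "compact (B c d)" "connected (B c d)"
        by (intro compact_Un compB conB; simp add: simps)+
      show "B d a \<union> B a c \<union> (B c b \<union> B b d) = J" by (auto simp: J_def)
      show "p a \<in> B d a \<union> B a c - B c d" "p b \<in> B c b \<union> B b d - B c d"
        by (simp_all add: simps)
    qed (use that * in simp_all)
  qed
  have "\<not> (K2 \<subseteq> F \<and> K1 \<subseteq> F)" "\<not> (K3 \<subseteq> F \<and> K1 \<subseteq> F)" "\<not> (K3 \<subseteq> F \<and> K2 \<subseteq> F)"
    if "F = inside J \<or> F = outside J" for F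
  proof -
    show "\<not> (K2 \<subseteq> F \<and> K1 \<subseteq> F)"
      using closB_open[of c d]
      by (intro AB that conK neK K2_int) (auto simp: simps doubleton_eq_iff K2_def)
    show "\<not> (K3 \<subseteq> F \<and> K1 \<subseteq> F)" by (intro AB that conK neK K3_int clK3) (auto simp: ne)
    show "\<not> (K3 \<subseteq> F \<and> K2 \<subseteq> F)" by (intro CD that conK neK K3_int clK3) (auto simp: ne)
  qed
  then show False
    using side[OF conK(1) K1_J] side[OF conK(2) K2_J] side[OF conK(3) K3_J] by blast
qed

section \<open>Isomorphism invariance and clique bounds\<close>

locale graph_iso =
  fixes f :: "'a \<Rightarrow> 'b" and V :: "'a set" and E :: "'a set set"
  assumes inj: "inj_on f V" and edges: "E \<subseteq> Pow V" and fin: "finite V"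
begin

abbreviation "V' \<equiv> f ` V"
abbreviation "E' \<equiv> (`) f ` E"

lemma edge_image_iff:
  assumes "u \<in> V"
  shows "{f u, y} \<in> E' \<longleftrightarrow> (\<exists>v\<in>V. y = f v \<and> {u, v} \<in> E)"
proof
  assume "{f u, y} \<in> E'"
  then obtain e where e: "e \<in> E" "{f u, y} = f ` e" by auto
  then obtain v where v: "v \<in> e" "y = f v" by blast
  have "f ` {u, v} = f ` e" using e v by auto
  moreover have "{u, v} \<subseteq> V" "e \<subseteq> V" using e v edges assms by auto
  ultimately have "{u, v} = e" using inj by (metis inj_on_image_eq_iff)
  then show "\<exists>v\<in>V. y = f v \<and> {u, v} \<in> E" using e v edges by auto
next
  assume "\<exists>v\<in>V. y = f v \<and> {u, v} \<in> E"
  then obtain v where "{u, v} \<in> E" "y = f v" by blast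
  then show "{f u, y} \<in> E'" by (intro image_eqI[of _ _ "{u, v}"]) auto
qed

lemma edge_image_iff':
  assumes "u \<in> V" "v \<in> V"
  shows "{f u, f v} \<in> E' \<longleftrightarrow> {u, v} \<in> E"
  using assms inj by (auto simp: edge_image_iff dest: inj_onD)

lemma card_edges_image: "card E' = card E"
  using inj edges by (intro card_image) (meson inj_on_image_Pow inj_on_subset)

lemma degree_image:
  assumes "u \<in> V"
  shows "degree E' (f u) = degree E u"
proof -
  have "{v. {f u, v} \<in> E'} = f ` {v. {u, v} \<in> E}"
    using edges by (auto simp: edge_image_iff[OF assms])
  moreover have "inj_on f {v. {u, v} \<in> E}"
    by (rule inj_on_subset[OF inj]) (use edges in auto)
  ultimately show ?thesis unfolding degree_def by (metis card_image)
qed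

lemma max_degree_image: "max_degree V' E' = max_degree V E"
proof -
  have "degree E' ` V' = degree E ` V" by (force simp: degree_image image_iff)
  then show ?thesis by (simp add: max_degree_def)
qed

lemma reachable_subset:
  assumes "(u, v) \<in> {(a, b). {a, b} \<in> E}\<^sup>*" "u \<in> V"
  shows "v \<in> V"
  using assms by (induction rule: rtrancl_induct) (use edges in auto)

text \<open>Paths lift: by injectivity, an edge of \<open>E'\<close> at \<open>f v\<close> comes
  from an edge of \<open>E\<close> at \<open>v\<close>.\<close>

lemma reachable_image:
  assumes "(f u, y) \<in> {(a, b). {a, b} \<in> E'}\<^sup>*" "u \<in> V"
  shows "\<exists>v. (u, v) \<in> {(a, b). {a, b} \<in> E}\<^sup>* \<and> y = f v"
  using assms(1)
proof (induction rule: rtrancl_induct)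
  case (step y z)
  then obtain v where v: "(u, v) \<in> {(a, b). {a, b} \<in> E}\<^sup>*" "y = f v" by blast
  have "v \<in> V" by (rule reachable_subset[OF v(1) assms(2)])
  moreover have "{f v, z} \<in> E'" using step(2) v(2) by simp
  ultimately obtain w where w: "z = f w" "{v, w} \<in> E" using edge_image_iff by auto
  then have "(u, w) \<in> {(a, b). {a, b} \<in> E}\<^sup>*"
    using v(1) by (auto intro: rtrancl_into_rtrancl)
  then show ?case using w by blast
qed auto

text \<open>A one-sided comparison is enough here, as in the clique and triangle lemmas below,
  because only upper bounds have to pass from \<open>V\<close> to its image.\<close>

lemma component_image_card:
  assumes "C' \<in> components_of V' E'"
  shows "\<exists>C\<in>components_of V E. card C' \<le> card C"
proof -
  obtain u where u: "u \<in> V" "C' = {v. (f u, v) \<in> {(a, b). {a, b} \<in> E'}\<^sup>*}"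
    using assms unfolding components_of_def by blast
  define C where "C = {v. (u, v) \<in> {(a, b). {a, b} \<in> E}\<^sup>*}"
  have "C \<subseteq> V" using reachable_subset u(1) by (auto simp: C_def)
  then have "finite C" using fin finite_subset by blast
  moreover have "C' \<subseteq> f ` C" using reachable_image u by (auto simp: C_def)
  ultimately have "card C' \<le> card C" by (meson surj_card_le)
  then show ?thesis using u unfolding components_of_def C_def by blast
qed

lemma clique_image:
  assumes "S' \<subseteq> V'" "clique S' E'"
  shows "\<exists>S\<subseteq>V. clique S E \<and> S' = f ` S \<and> card S' = card S"
proof -
  obtain S where S: "S \<subseteq> V" "S' = f ` S" using assms(1) by (meson subset_imageE)
  have "clique S E" unfolding clique_def
  proof (intro ballI impI)
    fix u v assume uv: "u \<in> S" "v \<in> S" "u \<noteq> v"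
    then have V: "u \<in> V" "v \<in> V" using S by auto
    then have "f u \<noteq> f v" using inj uv(3) by (auto dest: inj_onD)
    then have "{f u, f v} \<in> E'" using assms(2) S(2) uv by (simp add: clique_def)
    then show "{u, v} \<in> E" using edge_image_iff'[OF V] by simp
  qed
  moreover have "card S' = card S" using S by (simp add: card_image inj_on_subset[OF inj])
  ultimately show ?thesis using S by (intro exI[of _ S]) simp
qed

lemma card_triangles_image: "card (triangles V' E') \<le> card (triangles V E)"
proof -
  have "triangles V' E' \<subseteq> (`) f ` triangles V E"
  proof
    fix S' assume S': "S' \<in> triangles V' E'"
    then obtain S where "S \<subseteq> V" "clique S E" "S' = f ` S" "card S' = card S"
      using clique_image[of S'] unfolding triangles_def by blast
    then show "S' \<in> (`) f ` triangles V E"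
      using S' unfolding triangles_def by (intro image_eqI[of _ _ S]) auto
  qed
  moreover have "finite (triangles V E)" using fin by (simp add: triangles_def)
  ultimately show ?thesis by (meson surj_card_le)
qed

text \<open>The drawing is relabelled: with \<open>g\<close> inverting \<open>f\<close> on
  \<open>V\<close>, each vertex sits where its preimage sat and each edge keeps the curve of its
  preimage. Injectivity makes \<open>f\<close> commute with intersections of edges.\<close>

lemma planar_image:
  assumes "planar V E"
  shows "planar V' E'"
proof -
  obtain p :: "'a \<Rightarrow> complex" and curve where p: "inj_on p V"
    and arcs: "\<forall>e\<in>E. arc (curve e) \<and> {pathstart (curve e), pathfinish (curve e)} = p ` e \<and>
        path_image (curve e) \<inter> p ` V = p ` e"
    and disj: "\<forall>e\<in>E. \<forall>e'\<in>E. e \<noteq> e' \<longrightarrow>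
        path_image (curve e) \<inter> path_image (curve e') \<subseteq> p ` (e \<inter> e')"
    using assms(1) unfolding planar_def by (elim exE conjE) (rule that; assumption)
  define g where "g = inv_into V f"
  have g: "g (f v) = v" if "v \<in> V" for v using inj that by (simp add: g_def)
  have gV: "g ` f ` S = S" if "S \<subseteq> V" for S
    using that g by (force simp: image_iff)
  have pg: "(p \<circ> g) ` f ` S = p ` S" if "S \<subseteq> V" for S
    using gV[OF that] by (metis image_comp)
  have E: "e \<subseteq> V" if "e \<in> E" for e using that edges by auto
  show ?thesis unfolding planar_def
  proof (intro exI[of _ "p \<circ> g"] exI[of _ "\<lambda>e. curve (g ` e)"] conjI)
    show "inj_on (p \<circ> g) V'"
      using p g by (auto simp: inj_on_def)
    show "\<forall>e\<in>E'. arc (curve (g ` e)) \<and>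
        {pathstart (curve (g ` e)), pathfinish (curve (g ` e))} = (p \<circ> g) ` e \<and>
        path_image (curve (g ` e)) \<inter> (p \<circ> g) ` V' = (p \<circ> g) ` e"
      using arcs E by (simp add: pg gV del: o_apply)
    show "\<forall>e\<in>E'. \<forall>e'\<in>E'. e \<noteq> e' \<longrightarrow>
        path_image (curve (g ` e)) \<inter> path_image (curve (g ` e')) \<subseteq> (p \<circ> g) ` (e \<inter> e')"
    proof (intro ballI impI)
      fix h h' assume "h \<in> E'" "h' \<in> E'" "h \<noteq> h'"
      then obtain e e' where e: "h = f ` e" "h' = f ` e'" "e \<in> E" "e' \<in> E" "e \<noteq> e'" by auto
      have "f ` (e \<inter> e') = f ` e \<inter> f ` e'"
        using inj E[OF e(3)] E[OF e(4)] by (metis inj_on_image_Int)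
      then have "(p \<circ> g) ` (h \<inter> h') = p ` (e \<inter> e')"
        using pg[of "e \<inter> e'"] E[OF e(3)] e(1,2) by (metis inf.coboundedI1)
      then show "path_image (curve (g ` h)) \<inter> path_image (curve (g ` h')) \<subseteq> (p \<circ> g) ` (h \<inter> h')"
        using disj e E by (simp add: gV)
    qed
  qed
qed

end

section \<open>Edges of geometric graphs\<close>

lemma geo_edges_subset: "geo_edges V \<subseteq> Pow V"
  by (auto simp: geo_edges_def)

lemma doubleton_in_geo_edges_iff:
  "{u, v} \<in> geo_edges V \<longleftrightarrow> u \<in> V \<and> v \<in> V \<and> u \<noteq> v \<and> norm (u - v) \<le> 1"
  by (auto simp: geo_edges_def doubleton_eq_iff norm_minus_commute)

lemma geo_edges_image:
  assumes "inj_on f V" "\<And>u v. u \<in> V \<Longrightarrow> v \<in> V \<Longrightarrow> norm (f u - f v) \<le> 1 \<longleftrightarrow> norm (u - v) \<le> 1"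
  shows "geo_edges (f ` V) = (`) f ` geo_edges V"
proof (intro equalityI subsetI)
  fix e assume "e \<in> geo_edges (f ` V)"
  then obtain u v where "e = f ` {u, v}" "u \<in> V" "v \<in> V" "f u \<noteq> f v" "norm (f u - f v) \<le> 1"
    unfolding geo_edges_def by auto
  then show "e \<in> (`) f ` geo_edges V" using assms(2)
    by (intro image_eqI[of _ _ "{u, v}"]) (auto simp: doubleton_in_geo_edges_iff)
next
  fix e assume "e \<in> (`) f ` geo_edges V"
  then obtain u v where "e = {f u, f v}" "u \<in> V" "v \<in> V" "u \<noteq> v" "norm (u - v) \<le> 1"
    unfolding geo_edges_def by auto
  then show "e \<in> geo_edges (f ` V)" using assms
    by (auto simp: doubleton_in_geo_edges_iff dest: inj_onD)
qed

section \<open>Clique size against edge, degree, component and triangle counts\<close>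

lemma clique_card_le_edges:
  assumes "finite V" "S \<subseteq> V" "clique S E" "finite E"
  shows "card S \<le> card E + 1"
proof (cases "S = {}")
  case False
  then obtain u where u: "u \<in> S" by blast
  have "card (S - {u}) \<le> card E"
  proof (rule card_inj_on_le)
    show "inj_on (\<lambda>v. {u, v}) (S - {u})" by (auto simp: inj_on_def doubleton_eq_iff)
    show "(\<lambda>v. {u, v}) ` (S - {u}) \<subseteq> E" using assms(3) u by (auto simp: clique_def)
  qed (use assms in auto)
  then show ?thesis using u assms by simp
qed auto

lemma clique_card_le_max_degree:
  assumes "finite V" "S \<subseteq> V" "clique S E" "E \<subseteq> Pow V"
  shows "card S \<le> max_degree V E + 1"
proof (cases "S = {}")
  case False
  then obtain u where u: "u \<in> S" by blast
  have "card (S - {u}) \<le> degree E u" unfolding degree_def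
  proof (rule card_mono)
    show "finite {v. {u, v} \<in> E}" by (rule finite_subset[OF _ assms(1)]) (use assms(4) in auto)
    show "S - {u} \<subseteq> {v. {u, v} \<in> E}" using assms(3) u by (auto simp: clique_def)
  qed
  also have "degree E u \<le> max_degree V E" unfolding max_degree_def
    using assms u by (intro Max_ge) auto
  finally show ?thesis using u by simp
qed auto

lemma clique_card_le_component:
  assumes "finite V" "S \<subseteq> V" "clique S E" "E \<subseteq> Pow V" "S \<noteq> {}"
  shows "\<exists>C\<in>components_of V E. card S \<le> card C"
proof -
  \<comment> \<open>The identity relabelling gives access to
    \<open>reachable_subset\<close>.\<close>
  interpret graph_iso id V E using assms by unfold_locales auto
  obtain u where u: "u \<in> S" using assms(5) by blast
  define C where "C = {v. (u, v) \<in> {(a, b). {a, b} \<in> E}\<^sup>*}"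
  have "C \<subseteq> V" using reachable_subset u assms(2) by (auto simp: C_def)
  then have "finite C" using assms(1) finite_subset by blast
  moreover have "S \<subseteq> C"
  proof
    fix v assume "v \<in> S"
    then show "v \<in> C"
      using u assms(3) by (cases "u = v") (auto simp: C_def clique_def intro!: r_into_rtrancl)
  qed
  ultimately have "card S \<le> card C" by (rule card_mono)
  then show ?thesis using u assms(2) unfolding components_of_def C_def by blast
qed

text \<open>With two vertices of the clique fixed, each further vertex completes them to a different
  triangle.\<close>

lemma clique_card_le_triangles:
  assumes "finite V" "S \<subseteq> V" "clique S E"
  shows "card S \<le> card (triangles V E) + 2"
proof (cases "card S \<le> 2")
  case False
  have finS: "finite S" using assms finite_subset by blast
  obtain T where T: "T \<subseteq> S" "card T = 2" using False by (metis linorder_linear obtain_subset_with_card_n)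
  then have finT: "finite T" using finS finite_subset by blast
  have "card (S - T) \<le> card (triangles V E)"
  proof (rule card_inj_on_le)
    show "inj_on (\<lambda>v. insert v T) (S - T)" by (auto simp: inj_on_def)
    show "(\<lambda>v. insert v T) ` (S - T) \<subseteq> triangles V E"
      using assms T finT by (auto simp: triangles_def intro: smaller_clique)
    show "finite (triangles V E)" using assms(1) by (simp add: triangles_def)
  qed
  then show ?thesis using T finT finS by (simp add: card_Diff_subset)
qed auto

text \<open>\<open>iso\<close> compares only which pairs are within distance 1, not the distances
  themselves, so it covers perturbed configurations as well as arbitrary re-embeddings in the
  window.\<close>

locale graph_family =
  fixes lam :: real and A :: "(real ^ 'd) set set" and c :: nat
  assumes lam_pos: "lam > 0"
    and subset_configs: "A \<subseteq> configs lam"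
    and empty_in: "{} \<in> A"
    and iso: "\<lbrakk>V \<in> A; f ` V \<in> configs lam; inj_on f V;
      \<And>u v. u \<in> V \<Longrightarrow> v \<in> V \<Longrightarrow> norm (f u - f v) \<le> 1 \<longleftrightarrow> norm (u - v) \<le> 1\<rbrakk> \<Longrightarrow> f ` V \<in> A"
    and clique_bound: "\<lbrakk>V \<in> A; S \<subseteq> V; clique S (geo_edges V)\<rbrakk> \<Longrightarrow> card S \<le> c"

text \<open>\<open>l + 4\<close> is a common clique bound: the edge, degree, component and clique
  families give \<open>l + 1\<close>, triangles give \<open>l + 2\<close>, and planarity gives
  4.\<close>

lemma graph_families:
  fixes A :: "(real ^ 'd) set set"
  assumes "lam > 0"
    and A: "A \<in> {few_edges lam l, small_degree lam l, small_components lam l,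
              small_cliques lam l, few_triangles lam l, planar_configs lam}"
  shows "graph_family lam A (l + 4)"
proof
  show "lam > 0" by fact
  show sub: "A \<subseteq> configs lam"
    using A by (auto simp: few_edges_def small_degree_def small_components_def small_cliques_def
      few_triangles_def planar_configs_def)
  have "({} :: (real ^ 'd) set) \<in> configs lam" by (simp add: configs_def)
  moreover have "geo_edges ({} :: (real ^ 'd) set) = {}" by (auto simp: geo_edges_def)
  moreover have "triangles ({} :: (real ^ 'd) set) {} = {}" by (auto simp: triangles_def)
  moreover have "planar ({} :: (real ^ 'd) set) {}" by (auto simp: planar_def)
  ultimately show "{} \<in> A"
    using A by (auto simp: few_edges_def small_degree_def small_components_def small_cliques_def
      few_triangles_def planar_configs_def max_degree_def components_of_def)
  show "f ` V \<in> A" if V: "V \<in> A" "f ` V \<in> configs lam" "inj_on f V" and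
    adj: "\<And>u v. u \<in> V \<Longrightarrow> v \<in> V \<Longrightarrow> norm (f u - f v) \<le> 1 \<longleftrightarrow> norm (u - v) \<le> 1" for V and f
  proof -
    interpret graph_iso f V "geo_edges V"
      using V sub geo_edges_subset[of V] by unfold_locales (auto simp: configs_def)
    note eq = geo_edges_image[OF V(3) adj]
    consider "A = few_edges lam l" | "A = small_degree lam l" | "A = small_components lam l"
      | "A = small_cliques lam l" | "A = few_triangles lam l" | "A = planar_configs lam"
      using A by blast
    then show ?thesis
    proof cases
      case 1 then show ?thesis using V by (simp add: few_edges_def eq card_edges_image)
    next
      case 2 then show ?thesis using V by (simp add: small_degree_def eq max_degree_image)
    next
      case 3
      have "card C' \<le> l + 1" if C': "C' \<in> components_of V' E'" for C'
      proof -
        obtain C where "C \<in> components_of V (geo_edges V)" "card C' \<le> card C"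
          using component_image_card[OF C'] by blast
        moreover from this have "card C \<le> l + 1" using V 3 by (simp add: small_components_def)
        ultimately show ?thesis by simp
      qed
      then show ?thesis using V 3 by (simp add: small_components_def eq)
    next
      case 4
      have "card S' \<le> l + 1" if S': "S' \<subseteq> V'" "clique S' E'" for S'
      proof -
        obtain S where "S \<subseteq> V" "clique S (geo_edges V)" "card S' = card S"
          using clique_image[OF S'] by blast
        moreover from this have "card S \<le> l + 1" using V 4 by (simp add: small_cliques_def)
        ultimately show ?thesis by simp
      qed
      then show ?thesis using V 4 by (simp add: small_cliques_def eq)
    next
      case 5 then show ?thesis using V card_triangles_image by (simp add: few_triangles_def eq)
    next
      case 6 then show ?thesis using V planar_image by (simp add: planar_configs_def eq)
    qed
  qed
  show "card S \<le> l + 4" if V: "V \<in> A" "S \<subseteq> V" "clique S (geo_edges V)" for V S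
  proof -
    have fin: "finite V" "finite S" using V sub by (auto simp: configs_def intro: finite_subset)
    have finE: "finite (geo_edges V)" using fin geo_edges_subset finite_subset by blast
    consider "A = few_edges lam l" | "A = small_degree lam l" | "A = small_components lam l"
      | "A = small_cliques lam l" | "A = few_triangles lam l" | "A = planar_configs lam"
      using A by blast
    then show ?thesis
    proof cases
      case 1 then show ?thesis using V clique_card_le_edges[OF fin(1) V(2,3) finE]
        by (simp add: few_edges_def)
    next
      case 2 then show ?thesis using V clique_card_le_max_degree[OF fin(1) V(2,3) geo_edges_subset]
        by (simp add: small_degree_def)
    next
      case 3
      show ?thesis
      proof (cases "S = {}")
        case False
        then obtain C where "C \<in> components_of V (geo_edges V)" "card S \<le> card C"
          using clique_card_le_component[OF fin(1) V(2,3) geo_edges_subset] by blast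
        moreover from this have "card C \<le> l + 1" using V 3 by (simp add: small_components_def)
        ultimately show ?thesis by simp
      qed simp
    next
      case 4
      then have "card S \<le> l + 1" using V by (simp add: small_cliques_def)
      then show ?thesis by simp
    next
      case 5 then show ?thesis using V clique_card_le_triangles[OF fin(1) V(2,3)]
        by (simp add: few_triangles_def)
    next
      case 6 then show ?thesis using V planar_clique_card_le_4[of V "geo_edges V" S] fin
        by (simp add: planar_configs_def)
    qed
  qed
qed

section \<open>Configurations in the window and measurability\<close>

lemma window_eq_cbox: "window lam = cbox 0 (\<chi> i. lam)"
  by (auto simp: window_def mem_box_cart)

lemma window_borel [measurable, simp]: "window lam \<in> sets borel"
  by (simp add: window_eq_cbox)

lemma measure_window:
  assumes "lam > 0"
  shows "measure lborel (window lam :: (real ^ 'd) set) = lam ^ CARD('d)"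
proof -
  have "cbox 0 (\<chi> i. lam) \<noteq> ({} :: (real ^ 'd) set)"
    using assms by (auto simp: box_ne_empty inner_axis Basis_vec_def)
  then show ?thesis by (simp add: window_eq_cbox content_cbox_cart)
qed

lemma emeasure_window_finite: "emeasure lborel (window lam) < \<infinity>"
  by (simp add: window_eq_cbox emeasure_lborel_cbox_eq)

lemma set_first: "set (first n x) = x ` {..<n}"
  by (simp add: first_def lessThan_atLeast0)

context graph_family
begin

lemma card_bounded: "\<exists>K. \<forall>V\<in>A. card V \<le> K"
proof -
  have "compact (window lam :: (real ^ 'd) set)" by (simp add: window_eq_cbox)
  then obtain k where k: "finite k" "(window lam :: (real ^ 'd) set) \<subseteq> (\<Union>x\<in>k. ball x (1/2))"
    unfolding compact_eq_totally_bounded by (metis half_gt_zero zero_less_one)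
  have "card V \<le> card k * c" if V: "V \<in> A" for V
  proof -
    have "finite V" "V \<subseteq> window lam" using V subset_configs by (auto simp: configs_def)
    then have "V = (\<Union>x\<in>k. V \<inter> ball x (1/2))" using k by auto
    then have "card V \<le> (\<Sum>x\<in>k. card (V \<inter> ball x (1/2)))"
      using card_UN_le[OF k(1), of "\<lambda>x. V \<inter> ball x (1/2)"] by simp
    \<comment> \<open>Two points of one ball of radius 1/2 are at distance less than 1, so each ball
      meets \<open>V\<close> in a clique.\<close>
    also have "\<dots> \<le> (\<Sum>x\<in>k. c)"
    proof (intro sum_mono clique_bound[OF V])
      fix x :: "real ^ 'd"
      have "norm (u - v) \<le> 1" if "u \<in> ball x (1/2)" "v \<in> ball x (1/2)" for u v
        using that dist_triangle3[of u v x] by (simp add: dist_norm)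
      then show "clique (V \<inter> ball x (1/2)) (geo_edges V)"
        by (auto simp: clique_def doubleton_in_geo_edges_iff)
    qed auto
    finally show ?thesis by simp
  qed
  then show ?thesis by blast
qed

text \<open>Tuples may repeat points; matching the equalities of \<open>x\<close> and
  \<open>y\<close> makes the assignment of \<open>y i\<close> to \<open>x i\<close> a well-defined
  injection, to which \<open>iso\<close> applies.\<close>

lemma same_pattern:
  fixes n :: nat
  assumes "x ` {..<n} \<in> A" "y ` {..<n} \<subseteq> window lam"
    and eq: "\<And>i j. i < n \<Longrightarrow> j < n \<Longrightarrow> x i = x j \<longleftrightarrow> y i = y j"
    and adj: "\<And>i j. i < n \<Longrightarrow> j < n \<Longrightarrow> norm (x i - x j) \<le> 1 \<longleftrightarrow> norm (y i - y j) \<le> 1"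
  shows "y ` {..<n} \<in> A"
proof -
  define f where "f v = y (inv_into {..<n} x v)" for v
  have f: "f (x i) = y i" if "i < n" for i
  proof -
    have "inv_into {..<n} x (x i) \<in> {..<n}" "x (inv_into {..<n} x (x i)) = x i"
      using that by (auto intro!: inv_into_into f_inv_into_f simp del: lessThan_iff)
    then show ?thesis using eq that by (simp add: f_def)
  qed
  have eq_img: "f ` x ` {..<n} = y ` {..<n}" using f by force
  have "f ` x ` {..<n} \<in> A"
  proof (rule iso[OF assms(1)])
    show "f ` x ` {..<n} \<in> configs lam" unfolding eq_img using assms(2) by (auto simp: configs_def)
    show "inj_on f (x ` {..<n})" using f eq by (auto simp: inj_on_def)
  qed (use f adj in auto)
  then show ?thesis by (simp only: eq_img)
qed

text \<open>By \<open>same_pattern\<close>, membership in \<open>A\<close> of a tuple from the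
  window depends only on its pattern of equalities and adjacencies. There are finitely many
  patterns, each given by finitely many norm inequalities. Equality is written as norm at most 0 so
  that both relations are handled alike.\<close>

lemma tuples_measurable:
  fixes n :: nat
  shows "{x \<in> space (Pi\<^sub>M {..<n} (\<lambda>_. borel)). x ` {..<n} \<in> A} \<in> sets (Pi\<^sub>M {..<n} (\<lambda>_. borel))"
proof -
  let ?I = "{..<n}" and ?M = "Pi\<^sub>M {..<n} (\<lambda>_. borel :: (real ^ 'd) measure)"
  define pat :: "(nat \<Rightarrow> real ^ 'd) \<Rightarrow> (nat \<times> nat) set \<times> (nat \<times> nat) set"
    where "pat x = ({(i, j). i < n \<and> j < n \<and> norm (x i - x j) \<le> 0},
      {(i, j). i < n \<and> j < n \<and> norm (x i - x j) \<le> 1})" for x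
  define good where "good = {pat x |x. x ` ?I \<in> A}"
  have "good \<subseteq> Pow (?I \<times> ?I) \<times> Pow (?I \<times> ?I)" by (auto simp: good_def pat_def)
  then have fin: "finite good" by (rule finite_subset) auto
  have "x ` ?I \<in> A \<longleftrightarrow> (\<forall>i\<in>?I. x i \<in> window lam) \<and> pat x \<in> good" for x
  proof
    assume *: "x ` ?I \<in> A"
    then have "x ` ?I \<subseteq> window lam" using subset_configs by (auto simp: configs_def)
    then show "(\<forall>i\<in>?I. x i \<in> window lam) \<and> pat x \<in> good" using * by (auto simp: good_def)
  next
    assume *: "(\<forall>i\<in>?I. x i \<in> window lam) \<and> pat x \<in> good"
    then obtain y where y: "pat x = pat y" "y ` ?I \<in> A" by (auto simp: good_def)
    have "(y i = y j \<longleftrightarrow> x i = x j)" "(norm (y i - y j) \<le> 1 \<longleftrightarrow> norm (x i - x j) \<le> 1)"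
      if "i < n" "j < n" for i j
    proof -
      have "(i, j) \<in> fst (pat x) \<longleftrightarrow> (i, j) \<in> fst (pat y)"
        "(i, j) \<in> snd (pat x) \<longleftrightarrow> (i, j) \<in> snd (pat y)"
        by (simp_all add: y(1))
      then show "(y i = y j \<longleftrightarrow> x i = x j)" "(norm (y i - y j) \<le> 1 \<longleftrightarrow> norm (x i - x j) \<le> 1)"
        using that by (simp_all add: pat_def)
    qed
    moreover have "x ` ?I \<subseteq> window lam" using * by blast
    ultimately show "x ` ?I \<in> A" using y(2) by (intro same_pattern[of y n x])
  qed
  then have "{x \<in> space ?M. x ` ?I \<in> A} =
    {x \<in> space ?M. (\<forall>i\<in>?I. x i \<in> window lam) \<and> (\<exists>p\<in>good. pat x = p)}"
    by simp
  also have "\<dots> \<in> sets ?M"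
  proof (intro sets.sets_Collect_conj sets.sets_Collect_finite_Ex[OF _ fin])
    show "{x \<in> space ?M. \<forall>i\<in>?I. x i \<in> window lam} \<in> sets ?M" by measurable
  next
    fix p
    have aux: "{(i, j). i < n \<and> j < n \<and> Q i j} = s \<longleftrightarrow>
        s \<subseteq> ?I \<times> ?I \<and> (\<forall>i\<in>?I. \<forall>j\<in>?I. Q i j \<longleftrightarrow> (i, j) \<in> s)" for Q s
      by auto
    have eq: "pat x = p \<longleftrightarrow>
      (fst p \<subseteq> ?I \<times> ?I \<and> (\<forall>i\<in>?I. \<forall>j\<in>?I. norm (x i - x j) \<le> 0 \<longleftrightarrow> (i, j) \<in> fst p)) \<and>
      (snd p \<subseteq> ?I \<times> ?I \<and> (\<forall>i\<in>?I. \<forall>j\<in>?I. norm (x i - x j) \<le> 1 \<longleftrightarrow> (i, j) \<in> snd p))" for x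
      unfolding pat_def prod_eq_iff fst_conv snd_conv aux ..
    show "{x \<in> space ?M. pat x = p} \<in> sets ?M"
      unfolding eq by measurable
  qed
  finally show ?thesis .
qed

lemma injective_tuples_measurable:
  fixes n :: nat
  shows "{x \<in> space (Pi\<^sub>M {..<n} (\<lambda>_. borel)). inj_on x {..<n} \<and> x ` {..<n} \<in> A}
    \<in> sets (Pi\<^sub>M {..<n} (\<lambda>_. borel))"
proof (intro sets.sets_Collect_conj tuples_measurable)
  let ?M = "Pi\<^sub>M {..<n} (\<lambda>_. borel :: (real ^ 'd) measure)"
  have eq: "inj_on x {..<n} \<longleftrightarrow> (\<forall>i\<in>{..<n}. \<forall>j\<in>{..<n}. norm (x i - x j) = 0 \<longrightarrow> i = j)" for x :: "nat \<Rightarrow> real ^ 'd"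
    by (auto simp: inj_on_def)
  show "{x \<in> space ?M. inj_on x {..<n}} \<in> sets ?M"
    unfolding eq by measurable
qed

end

text \<open>Transfers measurability from counts of points in Borel sets, which is all that the definition of
  a Poisson process provides, to counts of tuples of points; the event that the process lies in \<open>A\<close> is
  expressible by the latter.\<close>

lemma count_tuples_measurable:
  fixes X :: "'w \<Rightarrow> 'a::euclidean_space set" and n :: nat
  assumes count: "\<And>B. B \<in> sets borel \<Longrightarrow> (\<lambda>w. card (X w \<inter> B)) \<in> measurable M (count_space UNIV)"
    and fin: "\<And>w. w \<in> space M \<Longrightarrow> finite (X w)"
    and D: "D \<in> sets (Pi\<^sub>M {..<n} (\<lambda>_. borel))"
  shows "(\<lambda>w. emeasure (count_space ({..<n} \<rightarrow>\<^sub>E X w)) (({..<n} \<rightarrow>\<^sub>E X w) \<inter> D)) \<in> borel_measurable M"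
proof -
  let ?P = "\<lambda>w. {..<n} \<rightarrow>\<^sub>E X w" and ?\<Omega> = "\<Pi>\<^sub>E i\<in>{..<n}. space (borel :: 'a measure)"
  let ?G = "{Pi\<^sub>E {..<n} B |B :: nat \<Rightarrow> 'a set. \<forall>i\<in>{..<n}. B i \<in> sets borel}"
  have finP: "finite (?P w)" if "w \<in> space M" for w using fin[OF that] by (simp add: finite_PiE)
  have gen: "sets (Pi\<^sub>M {..<n} (\<lambda>_. borel :: 'a measure)) = sigma_sets ?\<Omega> ?G"
  proof
    have "sets (Pi\<^sub>M {..<n} (\<lambda>_. borel :: 'a measure)) = sigma_sets ?\<Omega>
        {(\<Pi>\<^sub>E i\<in>{..<n}. B i) |B. (\<forall>i. B i \<in> sets borel) \<and> finite {i. B i \<noteq> space borel}}"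
      by (rule sets_PiM_finite)
    also have "\<dots> \<subseteq> sigma_sets ?\<Omega> ?G" by (rule sigma_sets_mono') auto
    finally show "sets (Pi\<^sub>M {..<n} (\<lambda>_. borel :: 'a measure)) \<subseteq> sigma_sets ?\<Omega> ?G" .
    have "?G \<subseteq> sets (Pi\<^sub>M {..<n} (\<lambda>_. borel :: 'a measure))" by (auto intro!: sets_PiM_I_finite)
    from sets.sigma_sets_subset[OF this]
    show "sigma_sets ?\<Omega> ?G \<subseteq> sets (Pi\<^sub>M {..<n} (\<lambda>_. borel :: 'a measure))"
      by (simp add: space_PiM)
  qed
  \<comment> \<open>On a rectangle the number of tuples is the product of the point counts of its
    sides; Dynkin induction extends measurability to all \<open>D\<close>.\<close>
  have rect: "(\<lambda>w. emeasure (count_space (?P w)) (?P w \<inter> Pi\<^sub>E {..<n} B)) \<in> borel_measurable M"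
    if B: "\<And>i. i \<in> {..<n} \<Longrightarrow> B i \<in> sets borel" for B
  proof -
    have "emeasure (count_space (?P w)) (?P w \<inter> Pi\<^sub>E {..<n} B) =
      ennreal (\<Prod>i<n. real (card (X w \<inter> B i)))" if "w \<in> space M" for w
    proof -
      have "?P w \<inter> Pi\<^sub>E {..<n} B = Pi\<^sub>E {..<n} (\<lambda>i. X w \<inter> B i)" by (rule PiE_Int)
      moreover have "card (Pi\<^sub>E {..<n} (\<lambda>i. X w \<inter> B i)) = (\<Prod>i<n. card (X w \<inter> B i))"
        by (rule card_PiE) auto
      moreover have "finite (?P w \<inter> Pi\<^sub>E {..<n} B)" using finP[OF that] by simp
      moreover have "emeasure (count_space (?P w)) (?P w \<inter> Pi\<^sub>E {..<n} B) = of_nat (card (?P w \<inter> Pi\<^sub>E {..<n} B))"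
        using calculation(3) by (intro emeasure_count_space_finite) auto
      ultimately show ?thesis
        by (simp add: ennreal_of_nat_eq_real_of_nat prod_ennreal)
    qed
    moreover have "(\<lambda>w. ennreal (\<Prod>i<n. real (card (X w \<inter> B i)))) \<in> borel_measurable M"
      using count B by (intro measurable_compose[OF _ measurable_ennreal] borel_measurable_prod) 
        (auto intro: measurable_compose[OF count])
    ultimately show ?thesis by (simp cong: measurable_cong)
  qed
  have "Int_stable ?G" by (rule Int_stable_PiE)
  moreover have "?G \<subseteq> Pow ?\<Omega>" by auto
  moreover have "D \<in> sigma_sets ?\<Omega> ?G" using D by (simp only: gen)
  ultimately show ?thesis
  proof (induction D rule: sigma_sets_induct_disjoint)
    case (basic A)
    then show ?case using rect by auto
  next
    case empty
    then show ?case by simp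
  next
    case (compl A)
    have "emeasure (count_space (?P w)) (?P w \<inter> (?\<Omega> - A)) =
      emeasure (count_space (?P w)) (?P w \<inter> Pi\<^sub>E {..<n} (\<lambda>_. UNIV)) - emeasure (count_space (?P w)) (?P w \<inter> A)"
      if "w \<in> space M" for w
    proof -
      have "?P w \<inter> (?\<Omega> - A) = (?P w \<inter> Pi\<^sub>E {..<n} (\<lambda>_. UNIV)) - (?P w \<inter> A)" by auto
      \<comment> \<open>Finiteness is what allows the tuple counts to be subtracted.\<close>
      moreover have "finite (?P w \<inter> A)" using finP[OF that] by simp
      ultimately show ?thesis by (simp only:) (rule emeasure_Diff, auto simp: emeasure_count_space_finite)
    qed
    moreover have "(\<lambda>w. emeasure (count_space (?P w)) (?P w \<inter> Pi\<^sub>E {..<n} (\<lambda>_. UNIV)) -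
      emeasure (count_space (?P w)) (?P w \<inter> A)) \<in> borel_measurable M"
      using compl by (intro borel_measurable_minus_ennreal rect) auto
    ultimately show ?case by (simp cong: measurable_cong)
  next
    case (union A)
    have eq: "emeasure (count_space (?P w)) (?P w \<inter> (\<Union>i. A i)) =
      (\<Sum>i. emeasure (count_space (?P w)) (?P w \<inter> A i))" for w
      using union(1) unfolding Int_UN_distrib
      by (intro suminf_emeasure[symmetric]) (auto simp: disjoint_family_on_def)
    show ?case unfolding eq by (intro borel_measurable_suminf_order union(3))
  qed
qed

lemma (in graph_family) event_measurable:
  fixes X :: "'w \<Rightarrow> (real ^ 'd) set"
  assumes "poisson_process M (window lam) kappa X"
  shows "{w \<in> space M. X w \<in> A} \<in> sets M"
proof -
  have X: "finite (X w)" "X w \<subseteq> window lam" if "w \<in> space M" for w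
    using assms that by (auto simp: poisson_process_def)
  \<comment> \<open>Counts are given only for Borel subsets of the window; intersecting with the
    window, which contains \<open>X w\<close>, removes the restriction.\<close>
  have count: "(\<lambda>w. card (X w \<inter> B)) \<in> measurable M (count_space UNIV)" if "B \<in> sets borel" for B
  proof -
    have "(\<lambda>w. card (X w \<inter> (B \<inter> window lam))) \<in> measurable M (count_space UNIV)"
      using assms that by (auto simp: poisson_process_def)
    moreover have "X w \<inter> (B \<inter> window lam) = X w \<inter> B" if "w \<in> space M" for w
      using X[OF that] by auto
    ultimately show ?thesis by (simp cong: measurable_cong)
  qed
  define D where "D n = {x \<in> space (Pi\<^sub>M {..<n} (\<lambda>_. borel)). inj_on x {..<n} \<and> x ` {..<n} \<in> A}" for n :: nat
  define N where "N n w = emeasure (count_space ({..<n} \<rightarrow>\<^sub>E X w)) (({..<n} \<rightarrow>\<^sub>E X w) \<inter> D n)" for n w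
  have meas: "N n \<in> borel_measurable M" for n
    unfolding N_def[abs_def] D_def
    using count X by (intro count_tuples_measurable injective_tuples_measurable) auto
  have card: "{w \<in> space M. card (X w \<inter> UNIV) = n} \<in> sets M" for n
    using measurable_sets[OF count[of UNIV], of "{n}"] by (simp add: vimage_def Int_def conj_commute)
  \<comment> \<open>For \<open>n = card (X w)\<close>, an injective \<open>n\<close>-tuple of points
    of \<open>X w\<close> exhausts \<open>X w\<close>. So the count \<open>N n w\<close> is nonzero
    exactly when some enumeration of \<open>X w\<close>, equivalently \<open>X w\<close> itself,
    lies in \<open>A\<close>.\<close>
  have "X w \<in> A \<longleftrightarrow> (\<exists>n. card (X w \<inter> UNIV) = n \<and> N n w \<noteq> 0)" if w: "w \<in> space M" for w
  proof -
    have "N n w \<noteq> 0 \<longleftrightarrow> ({..<n} \<rightarrow>\<^sub>E X w) \<inter> D n \<noteq> {}" for n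
      unfolding N_def by (subst emeasure_count_space_eq_0) auto
    moreover have "X w \<in> A \<longleftrightarrow> ({..<card (X w)} \<rightarrow>\<^sub>E X w) \<inter> D (card (X w)) \<noteq> {}"
    proof
      assume A: "X w \<in> A"
      obtain h where h: "bij_betw h {..<card (X w)} (X w)"
        using ex_bij_betw_nat_finite[OF X(1)[OF w]] by (auto simp: lessThan_atLeast0)
      define g where "g = restrict h {..<card (X w)}"
      have "g ` {..<card (X w)} = X w" "inj_on g {..<card (X w)}"
        using h by (auto simp: g_def bij_betw_def inj_on_def)
      then have "g \<in> ({..<card (X w)} \<rightarrow>\<^sub>E X w) \<inter> D (card (X w))"
        using A by (auto simp: D_def space_PiM g_def)
      then show "({..<card (X w)} \<rightarrow>\<^sub>E X w) \<inter> D (card (X w)) \<noteq> {}" by blast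
    next
      assume "({..<card (X w)} \<rightarrow>\<^sub>E X w) \<inter> D (card (X w)) \<noteq> {}"
      then obtain g where g: "g \<in> {..<card (X w)} \<rightarrow>\<^sub>E X w" "inj_on g {..<card (X w)}" "g ` {..<card (X w)} \<in> A"
        by (auto simp: D_def)
      then have "g ` {..<card (X w)} = X w"
        using X(1)[OF w] by (intro card_subset_eq) (auto simp: card_image)
      then show "X w \<in> A" using g by simp
    qed
    ultimately show ?thesis by simp
  qed
  then have eq: "{w \<in> space M. X w \<in> A} = {w \<in> space M. \<exists>n. card (X w \<inter> UNIV) = n \<and> N n w \<noteq> 0}" by auto
  have "{w \<in> space M. card (X w \<inter> UNIV) = n \<and> N n w \<noteq> 0} \<in> sets M" for n
  proof -
    have "{w \<in> space M. N n w \<noteq> 0} \<in> sets M"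
      using measurable_sets[OF meas, of "- {0}" n] by (simp add: vimage_def Int_def conj_commute)
    from sets.sets_Collect_conj[OF this card] show ?thesis .
  qed
  from sets.sets_Collect_countable_Ex[OF this] show ?thesis unfolding eq .
qed

section \<open>Robust configurations\<close>

lemma AE_not_in_negligible:
  assumes "negligible S" "S \<in> sets borel"
  shows "AE y in lborel. y \<notin> S"
  using assms by (intro AE_not_in) (simp add: null_sets_completion_iff negligible_iff_null_sets)

text \<open>The coordinates \<open>i\<close> and \<open>j\<close> of the infinite product have the
  two-fold product law as joint marginal, and there Fubini turns null sections into a null
  set.\<close>

lemma AE_iid_uniform_pair:
  fixes W :: "'a::euclidean_space set" and i j :: nat
  assumes W: "W \<in> sets borel" "prob_space (uniform_measure lborel W)"
    and B: "B \<in> sets (borel \<Otimes>\<^sub>M borel)" "\<And>x. AE y in lborel. (x, y) \<notin> B"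
    and ij: "i \<noteq> j"
  shows "AE x in iid_uniform W. (x i, x j) \<notin> B"
proof -
  let ?U = "uniform_measure lborel W"
  interpret U: prob_space ?U by fact
  interpret product_prob_space "\<lambda>_::nat. ?U" UNIV ..
  interpret UU: pair_sigma_finite ?U ?U ..
  have sets_pair: "sets (?U \<Otimes>\<^sub>M ?U) = sets (borel \<Otimes>\<^sub>M borel)"
    by (intro sets_pair_measure_cong) auto
  have B': "B \<in> sets (?U \<Otimes>\<^sub>M ?U)" using B(1) sets_pair by simp
  have "AE z in ?U \<Otimes>\<^sub>M ?U. z \<notin> B"
  proof (rule UU.AE_pair_measure)
    show "{x \<in> space (?U \<Otimes>\<^sub>M ?U). x \<notin> B} \<in> sets (?U \<Otimes>\<^sub>M ?U)" using B' by measurable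
    have "AE y in ?U. (x, y) \<notin> B" for x
      using W(1) B(2)[of x] by (intro AE_uniform_measureI) (auto elim: eventually_mono)
    then show "AE x in ?U. AE y in ?U. (x, y) \<notin> B" by simp
  qed
  then have "emeasure (?U \<Otimes>\<^sub>M ?U) B = 0"
    using B' AE_iff_measurable[of B "?U \<Otimes>\<^sub>M ?U" "\<lambda>z. z \<notin> B"] sets.sets_into_space[OF B'] by auto
  moreover have "(\<integral>\<^sup>+\<sigma>. indicator B (\<sigma> i, \<sigma> j) \<partial>PiM {i, j} (\<lambda>_. ?U)) =
      (\<integral>\<^sup>+z. indicator B (fst z, snd z) \<partial>(?U \<Otimes>\<^sub>M ?U))"
    using B' by (intro product_nn_integral_pair ij) (simp add: case_prod_unfold)
  moreover have "(\<integral>\<^sup>+z. indicator B (fst z, snd z) \<partial>(?U \<Otimes>\<^sub>M ?U)) = emeasure (?U \<Otimes>\<^sub>M ?U) B"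
    using B' by simp
  ultimately have "(\<integral>\<^sup>+\<sigma>. indicator B (\<sigma> i, \<sigma> j) \<partial>PiM {i, j} (\<lambda>_. ?U)) = 0" by simp
  moreover have "(\<lambda>\<sigma>. indicator B (\<sigma> i, \<sigma> j) :: ennreal) \<in> borel_measurable (PiM {i, j} (\<lambda>_. ?U))"
  proof -
    have "(\<lambda>\<sigma>. (\<sigma> i, \<sigma> j)) \<in> measurable (PiM {i, j} (\<lambda>_. ?U)) (?U \<Otimes>\<^sub>M ?U)"
      by (intro measurable_Pair measurable_component_singleton) auto
    from measurable_compose[OF this borel_measurable_indicator[OF B']] show ?thesis .
  qed
  ultimately have "AE \<sigma> in PiM {i, j} (\<lambda>_. ?U). (indicator B (\<sigma> i, \<sigma> j) :: ennreal) = 0"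
    by (simp add: nn_integral_0_iff_AE)
  then have "AE \<sigma> in PiM {i, j} (\<lambda>_. ?U). (\<sigma> i, \<sigma> j) \<notin> B"
    by (rule eventually_mono) (auto simp: indicator_def split: if_splits)
  then have "AE \<sigma> in distr (PiM UNIV (\<lambda>_. ?U)) (PiM {i, j} (\<lambda>_. ?U)) (\<lambda>x. restrict x {i, j}). (\<sigma> i, \<sigma> j) \<notin> B"
    by (subst distr_PiM_restrict_finite) auto
  from AE_distrD[OF _ this] show ?thesis
    unfolding iid_uniform_def by (simp add: measurable_restrict_subset)
qed

lemma prob_space_uniform_window:
  assumes "lam > 0"
  shows "prob_space (uniform_measure lborel (window lam :: (real ^ 'd) set))"
proof (rule prob_space_uniform_measure)
  have "measure lborel (window lam :: (real ^ 'd) set) > 0" using assms by (simp add: measure_window)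
  then show "emeasure lborel (window lam :: (real ^ 'd) set) \<noteq> 0" by (auto simp: measure_def)
  show "emeasure lborel (window lam :: (real ^ 'd) set) \<noteq> \<infinity>"
    using emeasure_window_finite[of lam, where 'a='d] by auto
qed

context graph_family
begin

lemma AE_iid_generic:
  "AE x in iid_uniform (window lam :: (real ^ 'd) set).
    (\<forall>i. x i \<in> interior (window lam)) \<and> (\<forall>i j. i \<noteq> j \<longrightarrow> norm (x i - x j) \<noteq> 0 \<and> norm (x i - x j) \<noteq> 1)"
proof -
  let ?W = "window lam :: (real ^ 'd) set"
  note prob = prob_space_uniform_window[OF lam_pos, where 'd='d]
  have "AE x in iid_uniform ?W. x i \<in> interior ?W" for i
    unfolding iid_uniform_def
  proof (rule AE_PiM_component)
    have "AE y in lborel. y \<notin> ?W - interior ?W"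
      by (rule AE_not_in_negligible) (auto simp: window_eq_cbox negligible_frontier_interval)
    then show "AE x in uniform_measure lborel ?W. x \<in> interior ?W"
      by (intro AE_uniform_measureI) (auto elim: eventually_mono)
  qed (use prob in auto)
  moreover have "AE x in iid_uniform ?W. norm (x i - x j) \<noteq> 0 \<and> norm (x i - x j) \<noteq> 1" if "i \<noteq> j" for i j
  proof -
    define B where "B = {z :: (real ^ 'd) \<times> (real ^ 'd). norm (fst z - snd z) = 0 \<or> norm (fst z - snd z) = 1}"
    have "AE x in iid_uniform ?W. (x i, x j) \<notin> B"
    proof (rule AE_iid_uniform_pair[OF _ prob _ _ that])
      have "closed B" unfolding B_def
        by (intro closed_Collect_disj closed_Collect_eq continuous_intros)
      then show "B \<in> sets (borel \<Otimes>\<^sub>M borel)" unfolding borel_prod by (rule borel_closed)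
      fix x :: "real ^ 'd"
      \<comment> \<open>The sphere of radius 0 accounts for coincidences, that of radius 1 for the
        critical distance.\<close>
      have "AE y in lborel. y \<notin> sphere x 0 \<union> sphere x 1"
        by (intro AE_not_in_negligible negligible_Un negligible_sphere) auto
      then show "AE y in lborel. (x, y) \<notin> B"
        by (rule eventually_mono) (auto simp: B_def dist_norm)
    qed simp
    then show ?thesis by (simp add: B_def)
  qed
  ultimately show ?thesis by (simp add: AE_all_countable)
qed

text \<open>Disjointness of the balls makes the Poisson counts in them independent and the
  \<open>n\<close> points distinct, so that \<open>robust n\<close> also provides a configuration of
  exactly \<open>n\<close> points in \<open>A\<close>.\<close>

definition robust :: "nat \<Rightarrow> bool" where
  "robust n \<longleftrightarrow> (\<exists>x r. 0 < r \<and> (\<forall>i<n. ball (x i) r \<subseteq> window lam) \<and>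
     disjoint_family_on (\<lambda>i. ball (x i) r) {..<n} \<and>
     (\<forall>y. (\<forall>i<n. y i \<in> ball (x i) r) \<longrightarrow> y ` {..<n} \<in> A))"

lemma robust_0: "robust 0"
  using empty_in by (auto simp: robust_def disjoint_family_on_def intro!: exI[of _ "1::real"])

lemma robust_bounded: "\<exists>K. \<forall>n. robust n \<longrightarrow> n \<le> K"
proof -
  obtain K where K: "\<And>V. V \<in> A \<Longrightarrow> card V \<le> K" using card_bounded by blast
  have "n \<le> K" if n: "robust n" for n
  proof -
    obtain x r where x: "0 < r" "disjoint_family_on (\<lambda>i. ball (x i) r) {..<n}"
      "\<And>y. (\<forall>i<n. y i \<in> ball (x i) r) \<Longrightarrow> y ` {..<n} \<in> A"
      using n unfolding robust_def by blast
    have "inj_on x {..<n}"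
    proof (rule inj_onI, rule ccontr)
      fix i j assume *: "i \<in> {..<n}" "j \<in> {..<n}" "x i = x j" "i \<noteq> j"
      then have "ball (x i) r \<inter> ball (x j) r = {}" by (intro disjoint_family_onD[OF x(2)])
      then show False using * x(1) by auto
    qed
    then have "n = card (x ` {..<n})" by (simp add: card_image)
    also have "\<dots> \<le> K" using x(1) by (intro K x(3)) auto
    finally show ?thesis .
  qed
  then show ?thesis by blast
qed

lemma robust_generic:
  assumes x: "x ` {..<n} \<in> A" "\<And>i. i < n \<Longrightarrow> x i \<in> interior (window lam)"
    and gen: "\<And>i j. i < n \<Longrightarrow> j < n \<Longrightarrow> i \<noteq> j \<Longrightarrow> norm (x i - x j) \<noteq> 0 \<and> norm (x i - x j) \<noteq> 1"
  shows "robust n"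
proof -
  have "\<forall>\<^sub>F r in at_right 0. ball (x i) r \<subseteq> window lam" if "i < n" for i
  proof -
    obtain e where "e > 0" "ball (x i) e \<subseteq> window lam"
      using x(2)[OF \<open>i < n\<close>] by (auto simp: mem_interior)
    then show ?thesis
      unfolding eventually_at_right_field by (meson order_trans subset_ball less_imp_le)
  qed
  moreover have small: "\<forall>\<^sub>F r in at_right 0. 2 * r < a" if "a > 0" for a :: real
    unfolding eventually_at_right_field using that by (intro exI[of _ "a / 2"]) auto
  \<comment> \<open>Moving two points by less than \<open>r\<close> each changes their distance by
    less than \<open>2 * r\<close>, too little to make them coincide or to carry the distance across
    1.\<close>
  then have "\<forall>\<^sub>F r in at_right 0. i \<noteq> j \<longrightarrow> 2 * r < dist (x i) (x j) \<and> 2 * r < \<bar>dist (x i) (x j) - 1\<bar>"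
    if "i < n" "j < n" for i j
  proof (cases "i = j")
    case False
    then have "dist (x i) (x j) > 0" "\<bar>dist (x i) (x j) - 1\<bar> > 0"
      using gen[OF that] by (simp_all add: dist_norm)
    then show ?thesis using small by (auto intro: eventually_conj elim: eventually_mono)
  qed simp
  ultimately have "\<forall>\<^sub>F r in at_right 0. (0::real) < r \<and> ((\<forall>i\<in>{..<n}. ball (x i) r \<subseteq> window lam) \<and>
      (\<forall>i\<in>{..<n}. \<forall>j\<in>{..<n}. i \<noteq> j \<longrightarrow> 2 * r < dist (x i) (x j) \<and> 2 * r < \<bar>dist (x i) (x j) - 1\<bar>))"
    by (intro eventually_conj eventually_ball_finite ballI eventually_at_right_less) simp_all
  from eventually_happens[OF this] obtain r :: real where r: "0 < r" "\<And>i. i < n \<Longrightarrow> ball (x i) r \<subseteq> window lam"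
      "\<And>i j. i < n \<Longrightarrow> j < n \<Longrightarrow> i \<noteq> j \<Longrightarrow> 2 * r < dist (x i) (x j) \<and> 2 * r < \<bar>dist (x i) (x j) - 1\<bar>"
    by (auto simp: trivial_limit_at_right_real)
  have near: "\<bar>dist a b - dist c d\<bar> < 2 * r" if "a \<in> ball c r" "b \<in> ball d r" for a b c d :: "real ^ 'd"
  proof -
    have "dist a b \<le> dist c a + dist c d + dist d b" "dist c d \<le> dist c a + dist a b + dist d b"
      by metric+
    then show ?thesis using that unfolding mem_ball by linarith
  qed
  show ?thesis unfolding robust_def
  proof (intro exI conjI allI impI)
    show "0 < r" by fact
    show "ball (x i) r \<subseteq> window lam" if "i < n" for i by (rule r(2)[OF that])
    show "disjoint_family_on (\<lambda>i. ball (x i) r) {..<n}"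
      unfolding disjoint_family_on_def
    proof (intro ballI impI equals0I)
      fix i j z assume *: "i \<in> {..<n}" "j \<in> {..<n}" "i \<noteq> j" "z \<in> ball (x i) r \<inter> ball (x j) r"
      then have "\<bar>dist z z - dist (x i) (x j)\<bar> < 2 * r" by (intro near) auto
      then show False using r(3)[of i j] * by simp
    qed
    fix y assume y: "\<forall>i<n. y i \<in> ball (x i) r"
    show "y ` {..<n} \<in> A"
    proof (rule same_pattern[OF x(1)])
      show "y ` {..<n} \<subseteq> window lam" using y r(2) by blast
      fix i j assume ij: "i < n" "j < n"
      have d: "\<bar>dist (y i) (y j) - dist (x i) (x j)\<bar> < 2 * r" using y ij by (intro near) auto
      show "x i = x j \<longleftrightarrow> y i = y j"
      proof (cases "i = j")
        case False
        have "dist (y i) (y j) > 0" "dist (x i) (x j) > 0" using d r(1) r(3)[OF ij False] by linarith+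
        then show ?thesis by simp
      qed simp
      show "norm (x i - x j) \<le> 1 \<longleftrightarrow> norm (y i - y j) \<le> 1"
      proof (cases "i = j")
        case False
        then show ?thesis using d r(1) r(3)[OF ij False] unfolding dist_norm by linarith
      qed simp
    qed
  qed
qed

definition max_robust :: nat where
  "max_robust = Max {n. robust n}"

lemma max_robust: "robust max_robust" "robust n \<Longrightarrow> n \<le> max_robust"
proof -
  obtain K where "\<forall>n. robust n \<longrightarrow> n \<le> K" using robust_bounded ..
  then have "{n. robust n} \<subseteq> {..K}" by auto
  then have fin: "finite {n. robust n}" by (rule finite_subset) simp
  show "robust max_robust" using Max_in[OF fin] robust_0 by (auto simp: max_robust_def)
  show "robust n \<Longrightarrow> n \<le> max_robust" using Max_ge[OF fin] by (simp add: max_robust_def)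
qed

text \<open>Almost every sequence is generic, and a generic initial segment in \<open>A\<close>
  certifies that its length is robust.\<close>

lemma AE_iid_not_in:
  "AE x in iid_uniform (window lam). \<forall>n>max_robust. set (first n x) \<notin> A"
  using AE_iid_generic
proof (rule eventually_mono, intro allI impI notI)
  fix x :: "nat \<Rightarrow> real ^ 'd" and n
  assume *: "(\<forall>i. x i \<in> interior (window lam)) \<and>
      (\<forall>i j. i \<noteq> j \<longrightarrow> norm (x i - x j) \<noteq> 0 \<and> norm (x i - x j) \<noteq> 1)"
    and "max_robust < n" "set (first n x) \<in> A"
  then have "robust n" using * by (intro robust_generic[of x n]) (auto simp: set_first)
  then show False using max_robust(2) \<open>max_robust < n\<close> by (meson not_le)
qed

text \<open>\<open>v\<close> is the product of the ball volumes. It is chosen before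
  \<open>M\<close>, \<open>kappa\<close> and \<open>X\<close>, which makes the bound uniform in the
  intensity.\<close>

lemma poisson_lower_bound:
  assumes "robust n"
  shows "\<exists>v>0. \<forall>M kappa (X :: 'w \<Rightarrow> (real ^ 'd) set). kappa > 0 \<longrightarrow> poisson_process M (window lam) kappa X \<longrightarrow>
    v * (exp (- (kappa * lam ^ CARD('d))) * kappa ^ n) \<le> measure M {w \<in> space M. X w \<in> A}"
proof -
  let ?W = "window lam :: (real ^ 'd) set"
  obtain x :: "nat \<Rightarrow> real ^ 'd" and r where r: "0 < r" and sub: "\<And>i. i < n \<Longrightarrow> ball (x i) r \<subseteq> ?W"
    and disj: "disjoint_family_on (\<lambda>i. ball (x i) r) {..<n}"
    and inA: "\<And>y. (\<forall>i<n. y i \<in> ball (x i) r) \<Longrightarrow> y ` {..<n} \<in> A"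
    using assms unfolding robust_def by blast
  \<comment> \<open>Cells 0 to \<open>n - 1\<close> are the balls and cell \<open>n\<close> is the
    rest of the window, so the \<open>Suc n\<close> cells partition it and their volumes sum to
    \<open>lam ^ CARD('d)\<close>.\<close>
  define B where "B i = (if i < n then ball (x i) r else ?W - (\<Union>j<n. ball (x j) r))" for i
  have B: "B i \<in> sets borel" "B i \<subseteq> ?W" for i using sub by (auto simp: B_def)
  have disjB: "disjoint_family_on B {..<Suc n}"
    using disj unfolding disjoint_family_on_def B_def by (auto simp: less_Suc_eq)
  have UB: "(\<Union>i<Suc n. B i) = ?W"
    using sub by (auto simp: B_def less_Suc_eq)
  define m where "m i = measure lborel (B i)" for i
  have finB: "emeasure lborel (B i) \<noteq> \<infinity>" for i
    using emeasure_mono[OF B(2)[of i], of lborel] emeasure_window_finite[of lam, where 'a='d]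
    by (auto simp: top_unique)
  have m_sum: "(\<Sum>i<Suc n. m i) = lam ^ CARD('d)"
    using measure_finite_Union[of "{..<Suc n}" B lborel] disjB B finB UB measure_window[OF lam_pos, where 'd='d]
    by (simp add: m_def image_subset_iff del: lessThan_Suc sum.lessThan_Suc)
  have m_pos: "m i > 0" if "i < n" for i
    using that r by (simp add: m_def B_def content_ball_pos)
  define v where "v = (\<Prod>i<n. m i)"
  show ?thesis
  proof (intro exI[of _ v] conjI allI impI)
    show "v > 0" unfolding v_def using m_pos by (intro prod_pos) auto
    fix M and kappa :: real and X :: "'w \<Rightarrow> (real ^ 'd) set"
    assume "kappa > 0" and P: "poisson_process M ?W kappa X"
    then interpret prob_space M by (simp add: poisson_process_def)
    have X: "finite (X w)" "X w \<subseteq> ?W" if "w \<in> space M" for w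
      using P that by (auto simp: poisson_process_def)
    have cnt: "prob {w \<in> space M. card (X w \<inter> B i) = k} = poisson_prob (kappa * m i) k" for i k
      using P B[of i] by (simp add: poisson_process_def m_def)
    have ind: "indep_vars (\<lambda>_. count_space UNIV) (\<lambda>i w. card (X w \<inter> B i)) {..<Suc n}"
    proof -
      have "\<forall>(m::nat) B. (\<forall>i<m. B i \<in> sets borel \<and> B i \<subseteq> ?W) \<and> disjoint_family_on B {..<m} \<longrightarrow>
          indep_vars (\<lambda>_. count_space UNIV) (\<lambda>i w. card (X w \<inter> B i)) {..<m}"
        using P unfolding poisson_process_def by (elim conjE)
      from mp[OF spec[OF spec[OF this]]] B disjB show ?thesis by simp
    qed
    define k where "k i = (if i < n then 1 else 0 :: nat)" for i
    define Ev where "Ev = (\<Inter>i\<in>{..<Suc n}. (\<lambda>w. card (X w \<inter> B i)) -` {k i} \<inter> space M)"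
    have vim: "(\<lambda>w. card (X w \<inter> B i)) -` {k i} \<inter> space M = {w \<in> space M. card (X w \<inter> B i) = k i}" for i
      by auto
    have "prob Ev = (\<Prod>i<Suc n. prob ((\<lambda>w. card (X w \<inter> B i)) -` {k i} \<inter> space M))"
      unfolding Ev_def by (intro indep_varsD[OF ind]) auto
    also have "\<dots> = (\<Prod>i<Suc n. poisson_prob (kappa * m i) (k i))"
      unfolding vim cnt ..
    also have "\<dots> = (\<Prod>i<Suc n. exp (- (kappa * m i)) * (if i < n then kappa * m i else 1))"
      by (intro prod.cong) (auto simp: poisson_prob_def k_def)
    also have "\<dots> = exp (- (kappa * (\<Sum>i<Suc n. m i))) * (\<Prod>i<Suc n. if i < n then kappa * m i else 1)"
      by (simp only: prod.distrib exp_sum[symmetric] finite_lessThan sum_negf sum_distrib_left)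
    also have "(\<Prod>i<Suc n. if i < n then kappa * m i else 1) = (\<Prod>i<n. kappa * m i)"
      by simp
    also have "\<dots> = kappa ^ n * v"
      by (simp add: v_def prod.distrib)
    finally have eq: "prob Ev = v * (exp (- (kappa * lam ^ CARD('d))) * kappa ^ n)"
      by (simp only: m_sum) simp
    have "prob Ev \<le> prob {w \<in> space M. X w \<in> A}"
    proof (rule finite_measure_mono)
      show "{w \<in> space M. X w \<in> A} \<in> events" by (rule event_measurable[OF P])
      show "Ev \<subseteq> {w \<in> space M. X w \<in> A}"
      proof
        fix w assume "w \<in> Ev"
        then have w: "w \<in> space M" and c: "\<And>i. i < Suc n \<Longrightarrow> card (X w \<inter> B i) = k i"
          unfolding Ev_def by blast+
        have "\<exists>y. X w \<inter> B i = {y}" if "i < n" for i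
          using c[of i] that by (auto simp: k_def card_1_singleton_iff)
        then obtain y where y: "\<And>i. i < n \<Longrightarrow> X w \<inter> B i = {y i}" by metis
        have "X w \<inter> B n = {}" using c[of n] X[OF w] by (simp add: k_def)
        moreover have "X w = (\<Union>i<Suc n. X w \<inter> B i)" using X(2)[OF w] UB by blast
        ultimately have "X w = (\<Union>i<n. X w \<inter> B i)" by (simp add: lessThan_Suc)
        also have "\<dots> = y ` {..<n}" using y by auto
        finally have "X w = y ` {..<n}" .
        moreover have "y i \<in> ball (x i) r" if "i < n" for i
          using y[OF that] that by (auto simp: B_def)
        ultimately show "w \<in> {w \<in> space M. X w \<in> A}" using inA w by auto
      qed
    qed
    then show "v * (exp (- (kappa * lam ^ CARD('d))) * kappa ^ n) \<le> prob {w \<in> space M. X w \<in> A}"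
      by (simp only: eq)
  qed
qed

end

section \<open>Bounds for the estimators\<close>

text \<open>Both \<open>Y\<close> and its mean lie between 0 and \<open>C\<close>, hence they differ
  by at most \<open>C\<close>.\<close>

lemma variance_le_square:
  fixes Y :: "'w \<Rightarrow> real"
  assumes "prob_space M" "AE w in M. 0 \<le> Y w \<and> Y w \<le> C" "0 \<le> C"
  shows "prob_space.variance M Y \<le> C\<^sup>2"
proof -
  interpret prob_space M by fact
  \<comment> \<open>If \<open>Z\<close> is not integrable, its integral is 0 by convention, which
    \<open>0 \<le> D\<close> covers.\<close>
  have bound: "expectation Z \<le> D" if "AE w in M. Z w \<le> D" "0 \<le> D" for Z :: "'w \<Rightarrow> real" and D
    using that by (cases "integrable M Z") (auto intro: integral_le_const simp: not_integrable_integral_eq)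
  have "expectation Y \<le> C" using assms by (intro bound) (auto elim: eventually_mono)
  moreover have "0 \<le> expectation Y"
    using assms(2) by (intro integral_nonneg_AE) (auto elim: eventually_mono)
  moreover have "(y - e)\<^sup>2 \<le> C\<^sup>2" if "0 \<le> y" "y \<le> C" "0 \<le> e" "e \<le> C" for y e :: real
    using that by (intro abs_le_square_iff[THEN iffD1]) auto
  ultimately have "(Y w - expectation Y)\<^sup>2 \<le> C\<^sup>2" if "0 \<le> Y w \<and> Y w \<le> C" for w
    using that by blast
  then show ?thesis
    using assms(2) by (intro bound) (auto elim: eventually_mono)
qed

lemma poisson_prob_sum_le:
  assumes "1 \<le> beta"
  shows "(\<Sum>n\<le>N. poisson_prob beta n) \<le> real (N + 1) * (exp (- beta) * beta ^ N)"
proof -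
  have "poisson_prob beta n \<le> exp (- beta) * beta ^ N" if "n \<le> N" for n
  proof -
    have "beta ^ n / fact n \<le> beta ^ n / 1"
      using assms by (intro divide_left_mono) auto
    also have "\<dots> \<le> beta ^ N" using assms that by (simp add: power_increasing)
    finally show ?thesis unfolding poisson_prob_def
      by (simp add: mult_left_mono flip: times_divide_eq_right)
  qed
  then have "(\<Sum>n\<le>N. poisson_prob beta n) \<le> (\<Sum>n\<le>N. exp (- beta) * beta ^ N)"
    by (intro sum_mono) auto
  then show ?thesis by (simp only: sum_constant card_atMost) simp
qed

text \<open>The common shape of both estimators: \<open>c n\<close> is the indicator for conditional
  Monte Carlo and the indicator times \<open>L\<close> for importance sampling.\<close>

lemma weighted_series_bounds:
  fixes c :: "nat \<Rightarrow> real"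
  assumes "1 \<le> beta" "\<And>n. 0 \<le> c n \<and> c n \<le> 1" "\<And>n. n > N \<Longrightarrow> c n = 0"
  shows "0 \<le> (\<Sum>n. poisson_prob beta n * c n) \<and>
    (\<Sum>n. poisson_prob beta n * c n) \<le> real (N + 1) * (exp (- beta) * beta ^ N)"
proof -
  have pos: "0 \<le> poisson_prob beta n" for n using assms(1) by (simp add: poisson_prob_def)
  have "(\<Sum>n. poisson_prob beta n * c n) = (\<Sum>n\<le>N. poisson_prob beta n * c n)"
    using assms(3) by (intro suminf_finite) (auto simp: not_le)
  moreover have "0 \<le> (\<Sum>n\<le>N. poisson_prob beta n * c n)"
    using assms(2) pos by (intro sum_nonneg mult_nonneg_nonneg) auto
  moreover have "(\<Sum>n\<le>N. poisson_prob beta n * c n) \<le> (\<Sum>n\<le>N. poisson_prob beta n)"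
    using assms(2) pos by (intro sum_mono mult_left_le) auto
  ultimately show ?thesis using poisson_prob_sum_le[OF assms(1), of N] by linarith
qed

section \<open>Both estimators against the Poisson probability\<close>

context graph_family
begin

lemma AE_cmc_bounds:
  assumes "1 \<le> beta"
  shows "AE x in iid_uniform (window lam). 0 \<le> cmc_estimator beta A x \<and>
    cmc_estimator beta A x \<le> real (max_robust + 1) * (exp (- beta) * beta ^ max_robust)"
  using AE_iid_not_in
  by (rule eventually_mono) (unfold cmc_estimator_def, intro weighted_series_bounds assms, auto)

text \<open>With test function 1, the density identity equates the \<open>mu\<close>-mean of the
  weight with the uniform probability of the event, which is 0 by \<open>AE_iid_not_in\<close>. A
  nonnegative integrable function with mean 0 vanishes almost everywhere.\<close>

lemma AE_importance_weight_zero: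
  assumes IS: "importance_sampling (window lam) A mu L" and n: "n > max_robust"
  shows "AE \<omega> in mu. stopped_ind A n \<omega> * L (first n (fst \<omega>)) = 0"
proof -
  let ?M = "Pi\<^sub>M {..<n} (\<lambda>_. borel :: (real ^ 'd) measure)"
  interpret prob_space mu using IS by (simp add: importance_sampling_def)
  have sets_mu: "sets mu = sets (Pi\<^sub>M UNIV (\<lambda>_. borel) \<Otimes>\<^sub>M count_space UNIV)"
    and L: "\<And>xs. set xs \<in> A \<Longrightarrow> 0 \<le> L xs \<and> L xs \<le> 1"
    and L_meas: "(\<lambda>x. L (first n x)) \<in> borel_measurable (restrict_space ?M {x. set (first n x) \<in> A})"
    and RN: "\<And>f :: (real ^ 'd) list \<Rightarrow> real.
        (\<lambda>x. f (first n x)) \<in> borel_measurable (Pi\<^sub>M {..<n} (\<lambda>_. restrict_space borel (window lam))) \<and>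
        bounded (f ` {xs. length xs = n \<and> set xs \<subseteq> window lam}) \<Longrightarrow>
        (\<integral>x. f (first n x) * of_bool (set (first n x) \<in> A) \<partial>iid_uniform (window lam)) =
        (\<integral>\<omega>. f (first n (fst \<omega>)) * stopped_ind A n \<omega> * L (first n (fst \<omega>)) \<partial>mu)"
    using IS unfolding importance_sampling_def by simp_all
  \<comment> \<open>\<open>L\<close> is measurable only on tuples with configuration in
    \<open>A\<close>; multiplying by the indicator extends it by 0 to a measurable function on all
    tuples.\<close>
  define g where "g x = indicator {x. set (first n x) \<in> A} x * L (first n x)" for x :: "nat \<Rightarrow> real ^ 'd"
  have g: "g \<in> borel_measurable ?M"
  proof -
    have "{x. set (first n x) \<in> A} \<inter> space ?M \<in> sets ?M"
      using tuples_measurable[of n] by (simp add: set_first Int_def conj_commute)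
    from iffD1[OF borel_measurable_restrict_space_iff[OF this] L_meas] show ?thesis
      by (simp add: g_def[abs_def])
  qed
  have first_restrict: "first n (restrict x {..<n}) = first n x" for x :: "nat \<Rightarrow> real ^ 'd"
    by (simp add: first_def)
  have eq: "stopped_ind A n \<omega> * L (first n (fst \<omega>)) =
      of_bool (enat n \<le> snd \<omega>) * g (restrict (fst \<omega>) {..<n})" for \<omega>
    by (simp add: stopped_ind_def g_def first_restrict case_prod_unfold indicator_def)
  have meas: "(\<lambda>\<omega>. stopped_ind A n \<omega> * L (first n (fst \<omega>))) \<in> borel_measurable mu"
    unfolding eq
  proof (rule borel_measurable_times)
    have "(\<lambda>\<omega>. restrict (fst \<omega>) {..<n}) \<in> measurable mu ?M"
      unfolding measurable_cong_sets[OF sets_mu refl]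
      by (rule measurable_compose[OF measurable_fst measurable_restrict_subset]) simp
    from measurable_compose[OF this g] show "(\<lambda>\<omega>. g (restrict (fst \<omega>) {..<n})) \<in> borel_measurable mu" .
    show "(\<lambda>\<omega>. of_bool (enat n \<le> snd \<omega>) :: real) \<in> borel_measurable mu"
      unfolding measurable_cong_sets[OF sets_mu refl]
      by (rule measurable_compose[OF measurable_snd]) simp
  qed
  have bounds: "0 \<le> stopped_ind A n \<omega> * L (first n (fst \<omega>)) \<and> stopped_ind A n \<omega> * L (first n (fst \<omega>)) \<le> 1" for \<omega>
    using L[of "first n (fst \<omega>)"] by (auto simp: stopped_ind_def case_prod_unfold)
  have "integrable mu (\<lambda>\<omega>. stopped_ind A n \<omega> * L (first n (fst \<omega>)))"
    using bounds meas by (intro integrable_const_bound[where B=1]) (auto simp: abs_le_iff)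
  moreover have "(\<integral>\<omega>. stopped_ind A n \<omega> * L (first n (fst \<omega>)) \<partial>mu) = 0"
  proof -
    have "(\<integral>\<omega>. stopped_ind A n \<omega> * L (first n (fst \<omega>)) \<partial>mu) =
        (\<integral>x. of_bool (set (first n x) \<in> A) \<partial>iid_uniform (window lam))"
      using RN[of "\<lambda>_. 1"] by (simp add: image_constant_conv)
    also have "\<dots> = 0"
      using AE_iid_not_in by (intro integral_eq_zero_AE) (use n in \<open>auto elim: eventually_mono\<close>)
    finally show ?thesis .
  qed
  ultimately show ?thesis
    using bounds by (subst integral_nonneg_eq_0_iff_AE[symmetric]) auto
qed

lemma AE_is_bounds:
  assumes "1 \<le> beta" "importance_sampling (window lam) A mu L"
  shows "AE \<omega> in mu. 0 \<le> is_estimator beta A L \<omega> \<and>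
    is_estimator beta A L \<omega> \<le> real (max_robust + 1) * (exp (- beta) * beta ^ max_robust)"
proof -
  have L: "0 \<le> L xs \<and> L xs \<le> 1" if "set xs \<in> A" for xs
    using assms(2) that by (simp add: importance_sampling_def)
  have "AE \<omega> in mu. \<forall>n>max_robust. stopped_ind A n \<omega> * L (first n (fst \<omega>)) = 0"
    using AE_importance_weight_zero[OF assms(2)] by (simp add: AE_all_countable)
  then show ?thesis
  proof (rule eventually_mono)
    fix \<omega> assume "\<forall>n>max_robust. stopped_ind A n \<omega> * L (first n (fst \<omega>)) = 0"
    moreover have "0 \<le> stopped_ind A n \<omega> * L (first n (fst \<omega>)) \<and> stopped_ind A n \<omega> * L (first n (fst \<omega>)) \<le> 1" for n
      using L[of "first n (fst \<omega>)"] by (auto simp: stopped_ind_def case_prod_unfold)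
    ultimately show "0 \<le> is_estimator beta A L \<omega> \<and>
      is_estimator beta A L \<omega> \<le> real (max_robust + 1) * (exp (- beta) * beta ^ max_robust)"
      unfolding is_estimator_def mult.assoc by (intro weighted_series_bounds assms(1)) auto
  qed
qed

lemma bounded_relative_variance:
  fixes M :: "real \<Rightarrow> 'w measure" and X :: "real \<Rightarrow> 'w \<Rightarrow> (real ^ 'd) set"
  assumes poisson: "\<And>kappa. kappa > 0 \<Longrightarrow> poisson_process (M kappa) (window lam) kappa (X kappa)"
    and "prob_space Q"
    and Y: "\<And>beta. 1 \<le> beta \<Longrightarrow> AE w in Q. 0 \<le> Y beta w \<and>
      Y beta w \<le> real (max_robust + 1) * (exp (- beta) * beta ^ max_robust)"
  shows "Limsup at_top (\<lambda>kappa. relative_variance Q (Y (kappa * lam ^ CARD('d)))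
    (measure (M kappa) {w \<in> space (M kappa). X kappa w \<in> A})) < \<infinity>"
proof -
  obtain v where v: "v > 0" and low: "\<And>kappa. kappa > 0 \<Longrightarrow>
      v * (exp (- (kappa * lam ^ CARD('d))) * kappa ^ max_robust) \<le>
      measure (M kappa) {w \<in> space (M kappa). X kappa w \<in> A}"
    using poisson_lower_bound[OF max_robust(1), where 'w='w] poisson by blast
  \<comment> \<open>\<open>K\<close> is the quotient of the two bounds: with
    \<open>beta = kappa * lam ^ CARD('d)\<close>, both \<open>kappa ^ max_robust\<close> and the
    exponential cancel.\<close>
  define K where "K = real (max_robust + 1) * (lam ^ CARD('d)) ^ max_robust / v"
  have "relative_variance Q (Y (kappa * lam ^ CARD('d)))
      (measure (M kappa) {w \<in> space (M kappa). X kappa w \<in> A}) \<le> ereal (K\<^sup>2)"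
    \<comment> \<open>This threshold says exactly that \<open>beta\<close> is at least 1.\<close>
    if kappa: "kappa \<ge> 1 / lam ^ CARD('d)" for kappa
  proof -
    define beta p where "beta = kappa * lam ^ CARD('d)"
      and "p = measure (M kappa) {w \<in> space (M kappa). X kappa w \<in> A}"
    have lp: "lam ^ CARD('d) > 0" using lam_pos by simp
    then have "kappa > 0" using kappa by (meson divide_pos_pos less_le_trans zero_less_one)
    have beta: "1 \<le> beta" using kappa lp by (simp add: beta_def field_simps)
    define q where "q = exp (- beta) * kappa ^ max_robust"
    have q: "q > 0" using \<open>kappa > 0\<close> by (simp add: q_def)
    have p: "v * q \<le> p" using low[OF \<open>kappa > 0\<close>] by (simp add: p_def q_def beta_def)
    \<comment> \<open>Positivity of \<open>p\<close> turns the \<open>ereal\<close> quotient in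
      \<open>relative_variance\<close> into a real one.\<close>
    then have "p > 0" using v q by (meson mult_pos_pos less_le_trans)
    define C where "C = real (max_robust + 1) * (exp (- beta) * beta ^ max_robust)"
    have "C = K * (v * q)"
      using v by (simp add: C_def K_def q_def beta_def power_mult_distrib)
    also have "\<dots> \<le> K * p" using p v lp by (intro mult_left_mono) (simp_all add: K_def)
    finally have "C \<le> K * p" .
    have "0 \<le> C" using beta by (simp add: C_def)
    have "prob_space.variance Q (Y beta) \<le> C\<^sup>2"
      using variance_le_square[OF assms(2) Y[OF beta, folded C_def] \<open>0 \<le> C\<close>] .
    also have "\<dots> \<le> (K * p)\<^sup>2" using \<open>C \<le> K * p\<close> \<open>0 \<le> C\<close> by (rule power_mono)
    finally have "prob_space.variance Q (Y beta) / p\<^sup>2 \<le> K\<^sup>2"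
      using \<open>p > 0\<close> by (simp add: divide_le_eq power_mult_distrib)
    then show ?thesis
      using \<open>p > 0\<close> unfolding relative_variance_def beta_def[symmetric] p_def[symmetric] by simp
  qed
  then have "Limsup at_top (\<lambda>kappa. relative_variance Q (Y (kappa * lam ^ CARD('d)))
    (measure (M kappa) {w \<in> space (M kappa). X kappa w \<in> A})) \<le> ereal (K\<^sup>2)"
    by (intro Limsup_bounded) (auto simp: eventually_at_top_linorder)
  then show ?thesis by (rule le_less_trans) simp
qed

end

theorem corollary1:
  fixes lam :: real and l :: nat
    and A :: "(real ^ 'd) set set"
    and M :: "real \<Rightarrow> 'w measure" and X :: "real \<Rightarrow> 'w \<Rightarrow> (real ^ 'd) set"
    and mu :: "((nat \<Rightarrow> real ^ 'd) \<times> enat) measure" and L :: "(real ^ 'd) list \<Rightarrow> real"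
  defines "p \<equiv> \<lambda>kappa. measure (M kappa) {w \<in> space (M kappa). X kappa w \<in> A}"
    and "beta \<equiv> \<lambda>kappa. kappa * lam ^ CARD('d)"
  assumes "lam > 0"
    and "A \<in> {few_edges lam l, small_degree lam l, small_components lam l,
              small_cliques lam l, few_triangles lam l, planar_configs lam}"
    and "\<And>kappa. kappa > 0 \<Longrightarrow> poisson_process (M kappa) (window lam) kappa (X kappa)"
    and "importance_sampling (window lam) A mu L"
  shows "Limsup at_top (\<lambda>kappa. relative_variance (iid_uniform (window lam))
           (cmc_estimator (beta kappa) A) (p kappa)) < \<infinity> \<and>
         Limsup at_top (\<lambda>kappa. relative_variance mu
           (is_estimator (beta kappa) A L) (p kappa)) < \<infinity>"
proof -
  interpret graph_family lam A "l + 4"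
    using assms(3,4) by (rule graph_families)
  have "prob_space (iid_uniform (window lam :: (real ^ 'd) set))"
    unfolding iid_uniform_def using assms(3) by (intro prob_space_PiM prob_space_uniform_window)
  moreover have "prob_space mu" using assms(6) by (simp add: importance_sampling_def)
  ultimately show ?thesis
    unfolding p_def beta_def
    using AE_cmc_bounds AE_is_bounds[OF _ assms(6)]
    by (intro conjI bounded_relative_variance assms(5))
qed

end
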